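(* Let $A:\mathcal F_\lambda\otimes\mathcal F_\gamma\otimes\mathcal F_\tau\to\mathcal F_{\lambda+\gamma+\tau+6}$ be a $\mathfrak{vect}(1)$-invariant ternary differential operator of order $6$. Then, up to permutations and dualizations, $A$ is a multiple of one of the following operators, evaluated on $\varphi(dx)^\lambda\otimes\psi(dx)^\gamma\otimes\chi(dx)^\tau$: (1) for $(\lambda,\gamma,\tau)=(0,0,0)$: $\ \Delta_{1,3}(d\varphi,d\psi,d\chi)$; (2) for $(\lambda,\gamma,\tau)=(0,0,-\frac52)$: $\ \Xi(\chi(dx)^{-5/2},d\varphi,d\psi)$; (3) for $(\lambda,\gamma,\tau)=(-\frac54,-\frac54,-\frac54)$: $\ \Upsilon(\varphi(dx)^{-5/4},\psi(dx)^{-5/4},\chi(dx)^{-5/4})$.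
   Context: For $\lambda\in\mathbb R$, $\mathcal F_\lambda=\{f(dx)^\lambda : f\in\mathbb R[x]\}$ is the space of weighted densities of weight $\lambda$ on $\mathbb R$. The Lie algebra $\mathfrak{vect}(1)$ of polynomial vector fields $X=h\frac{d}{dx}$, $h\in\mathbb R[x]$, acts on $\mathcal F_\lambda$ by $L_X(f(dx)^\lambda)=(hf'+\lambda h'f)(dx)^\lambda$; $\mathcal F_0$ is the space of functions. A ternary differential operator $A:\mathcal F_\lambda\otimes\mathcal F_\gamma\otimes\mathcal F_\tau\to\mathcal F_\mu$ is $\mathfrak{vect}(1)$-invariant if $L_X A(a,b,c)=A(L_Xa,b,c)+A(a,L_Xb,c)+A(a,b,L_Xc)$ for all $X\in\mathfrak{vect}(1)$. An invariant operator of order $k$ has the form $\varphi(dx)^\lambda\otimes\psi(dx)^\gamma\otimes\chi(dx)^\tau\mapsto\sum_{i+j+l=k}\alpha_{i,j,l}\varphi^{(i)}\psi^{(j)}\chi^{(l)}(dx)^\mu$ with constants $\alpha_{i,j,l}\in\mathbb R$ and $\mu=\lambda+\gamma+\tau+k$. De Rham differential: $d:\mathcal F_0\to\mathcal F_1$, $d\varphi=\varphi'dx$. Dualizations: for $A=\sum\alpha_{i,j,l}\varphi^{(i)}\psi^{(j)}\chi^{(l)}$ from $\mathcal F_\lambda\otimes\mathcal F_\gamma\otimes\mathcal F_\tau$ to $\mathcal F_\mu$, the three dualizations are the formal adjoints (via integration by parts, $(\mathcal F_\alpha)^*:=\mathcal F_{1-\alpha}$) in each argument. $A^{*1}:\mathcal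 F_{1-\mu}\otimes\mathcal F_\gamma\otimes\mathcal F_\tau\to\mathcal F_{1-\lambda}$ is $(\omega,\psi,\chi)\mapsto\sum\alpha_{i,j,l}(-1)^i(\omega\psi^{(j)}\chi^{(l)})^{(i)}$; $A^{*2}:\mathcal F_\lambda\otimes\mathcal F_{1-\mu}\otimes\mathcal F_\tau\to\mathcal F_{1-\gamma}$ and $A^{*3}:\mathcal F_\lambda\otimes\mathcal F_\gamma\otimes\mathcal F_{1-\mu}\to\mathcal F_{1-\tau}$ are defined analogously. Permutations: for $\sigma\in S_3$, $A^\sigma(a,b,c)=A(\sigma^{-1}(a,b,c))$, with the weights permuted accordingly. "Up to permutations and dualizations" means after applying finitely many of these operations. For $\lambda\in\mathbb R$, $\Delta_{\lambda,3}:\wedge^3\mathcal F_\lambda\to\mathcal F_{3\lambda+3}$ is $\begin{vmatrix}\varphi&\psi&\chi\\ \varphi'&\psi'&\chi'\\ \varphi''&\psi''&\chi''\end{vmatrix}(dx)^{3\lambda+3}$. For $\tau\neq-\frac34$, $\Xi:\mathcal F_{-\tau-3/2}\otimes\mathcal F_\tau\otimes\mathcal F_\tau\to\mathcal F_{\tau+5/2}$ is $\sum_{i+j+l=4}\alpha_{i,j,l}\varphi^{(i)}\psi^{(j)}\chi^{(l)}(dx)^{\tau+5/2}$ with $\alpha_{4,0,0}=\alpha_{0,2,2}=\alpha_{2,1,1}=0$, $\alpha_{0,4,0}=-\tau(3+2\tau)$, $\alpha_{0,0,4}=\tau(3+2\tau)$, $\alpha_{3,1,0}=-\frac83\tau(2+3\tau)$,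 $\alpha_{3,0,1}=\frac83\tau(2+3\tau)$, $\alpha_{1,3,0}=-\frac23\tau(13+12\tau)$, $\alpha_{1,0,3}=\frac23\tau(13+12\tau)$, $\alpha_{0,3,1}=\frac53(3+2\tau)$, $\alpha_{0,1,3}=-\frac53(3+2\tau)$, $\alpha_{2,2,0}=-4\tau(2+3\tau)$, $\alpha_{2,0,2}=4\tau(2+3\tau)$, $\alpha_{1,2,1}=10(1+\tau)$, $\alpha_{1,1,2}=-10(1+\tau)$. In case (2), $\Xi$ is taken with $\tau=1$. $\Upsilon:\wedge^3\mathcal F_{-5/4}\to\mathcal F_{9/4}$ is $$\left(\begin{vmatrix}\varphi&\psi&\chi\\ \varphi'&\psi'&\chi'\\ \varphi^{(5)}&\psi^{(5)}&\chi^{(5)}\end{vmatrix}+\frac52\begin{vmatrix}\varphi&\psi&\chi\\ \varphi''&\psi''&\chi''\\ \varphi^{(4)}&\psi^{(4)}&\chi^{(4)}\end{vmatrix}+2\begin{vmatrix}\varphi'&\psi'&\chi'\\ \varphi''&\psi''&\chi''\\ \varphi^{(3)}&\psi^{(3)}&\chi^{(3)}\end{vmatrix}\right)(dx)^{9/4}.$$ *)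

theory Defs
  imports
    "HOL-Analysis.Analysis"
    "HOL-Computational_Algebra.Polynomial"
begin

text \<open>
  A density f(dx)^lam is represented by its coefficient f, a real polynomial; the weights of the
  three arguments and of the value are carried by the operator.  An operator on the tensor product
  is given as a function of three polynomials.
\<close>

type_synonym poly_map3 = "real poly \<Rightarrow> real poly \<Rightarrow> real poly \<Rightarrow> real poly"

datatype ternary_op =
  Ternary (wt1: real) (wt2: real) (wt3: real) (wt_target: real) (op_map: poly_map3)

abbreviation nth_pderiv :: "nat \<Rightarrow> real poly \<Rightarrow> real poly" where
  "nth_pderiv n f \<equiv> (pderiv ^^ n) f"

text \<open>The action on densities of weight lam of the vector field h d/dx.\<close>

definition lie_derivative :: "real \<Rightarrow> real poly \<Rightarrow> real poly \<Rightarrow> real poly" where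
  "lie_derivative lam h f = h * pderiv f + smult lam (pderiv h * f)"

definition vect1_invariant :: "ternary_op \<Rightarrow> bool" where
  "vect1_invariant A \<longleftrightarrow>
    (\<forall>h a b c.
      lie_derivative (wt_target A) h (op_map A a b c) =
        op_map A (lie_derivative (wt1 A) h a) b c +
        op_map A a (lie_derivative (wt2 A) h b) c +
        op_map A a b (lie_derivative (wt3 A) h c))"

text \<open>
  The order is exact: some coefficient of total order k is nonzero, so the zero map has no order.
  Coefficients may depend on x here; that they are constants of total order k for an invariant
  operator is a consequence, not an assumption.
\<close>

definition diff_op_of_order :: "nat \<Rightarrow> poly_map3 \<Rightarrow> bool" where
  "diff_op_of_order k F \<longleftrightarrow>
    (\<exists>p :: nat \<Rightarrow> nat \<Rightarrow> nat \<Rightarrow> real poly.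
      (\<exists>i j l. i + j + l = k \<and> p i j l \<noteq> 0) \<and>
      F = (\<lambda>\<phi> \<psi> \<theta>. \<Sum>(i, j, l) \<in> {(i, j, l). i + j + l \<le> k}.
             p i j l * nth_pderiv i \<phi> * nth_pderiv j \<psi> * nth_pderiv l \<theta>))"

definition const_diff_op :: "nat \<Rightarrow> (nat \<Rightarrow> nat \<Rightarrow> nat \<Rightarrow> real) \<Rightarrow> poly_map3" where
  "const_diff_op k \<alpha> = (\<lambda>\<phi> \<psi> \<theta>. \<Sum>(i, j, l) \<in> {(i, j, l). i + j + l = k}.
     smult (\<alpha> i j l) (nth_pderiv i \<phi> * nth_pderiv j \<psi> * nth_pderiv l \<theta>))"


text \<open>
  Dualizations are relations between operators, since the formal adjoint is written in terms of
  the coefficients (which the operator determines).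
\<close>

definition dualization1 :: "ternary_op \<Rightarrow> ternary_op \<Rightarrow> bool" where
  "dualization1 A B \<longleftrightarrow>
    (\<exists>k \<alpha>. op_map A = const_diff_op k \<alpha> \<and>
      B = Ternary (1 - wt_target A) (wt2 A) (wt3 A) (1 - wt1 A)
        (\<lambda>\<omega> \<psi> \<theta>. \<Sum>(i, j, l) \<in> {(i, j, l). i + j + l = k}.
          smult (\<alpha> i j l * (-1) ^ i)
            (nth_pderiv i (\<omega> * nth_pderiv j \<psi> * nth_pderiv l \<theta>))))"

definition dualization2 :: "ternary_op \<Rightarrow> ternary_op \<Rightarrow> bool" where
  "dualization2 A B \<longleftrightarrow>
    (\<exists>k \<alpha>. op_map A = const_diff_op k \<alpha> \<and>
      B = Ternary (wt1 A) (1 - wt_target A) (wt3 A) (1 - wt2 A)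
        (\<lambda>\<phi> \<omega> \<theta>. \<Sum>(i, j, l) \<in> {(i, j, l). i + j + l = k}.
          smult (\<alpha> i j l * (-1) ^ j)
            (nth_pderiv j (nth_pderiv i \<phi> * \<omega> * nth_pderiv l \<theta>))))"

definition dualization3 :: "ternary_op \<Rightarrow> ternary_op \<Rightarrow> bool" where
  "dualization3 A B \<longleftrightarrow>
    (\<exists>k \<alpha>. op_map A = const_diff_op k \<alpha> \<and>
      B = Ternary (wt1 A) (wt2 A) (1 - wt_target A) (1 - wt3 A)
        (\<lambda>\<phi> \<psi> \<omega>. \<Sum>(i, j, l) \<in> {(i, j, l). i + j + l = k}.
          smult (\<alpha> i j l * (-1) ^ l)
            (nth_pderiv l (nth_pderiv i \<phi> * nth_pderiv j \<psi> * \<omega>))))"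

text \<open>
  Permutations act on triples by moving the entry in place i to place s(i).  Hence the inverse of s
  sends (x(0), x(1), x(2)) to (x(s(0)), x(s(1)), x(s(2))), and the weight expected in place i by
  the permuted operator is the one in place (inv s)(i) of the original operator.
\<close>

definition permute_op :: "(nat \<Rightarrow> nat) \<Rightarrow> ternary_op \<Rightarrow> ternary_op" where
  "permute_op s A =
    (let w = [wt1 A, wt2 A, wt3 A] in
     Ternary (w ! inv s 0) (w ! inv s 1) (w ! inv s 2) (wt_target A)
       (\<lambda>a b c. let x = [a, b, c] in op_map A (x ! s 0) (x ! s 1) (x ! s 2)))"

definition perm_or_dual :: "ternary_op \<Rightarrow> ternary_op \<Rightarrow> bool" where
  "perm_or_dual A B \<longleftrightarrow>
    (\<exists>s. s permutes {0, 1, 2} \<and> B = permute_op s A) \<or>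
    dualization1 A B \<or> dualization2 A B \<or> dualization3 A B"

definition perm_dual_related :: "ternary_op \<Rightarrow> ternary_op \<Rightarrow> bool" where
  "perm_dual_related = perm_or_dual\<^sup>*\<^sup>*"

definition scale_op :: "real \<Rightarrow> ternary_op \<Rightarrow> ternary_op" where
  "scale_op c A =
    Ternary (wt1 A) (wt2 A) (wt3 A) (wt_target A) (\<lambda>\<phi> \<psi> \<theta>. smult c (op_map A \<phi> \<psi> \<theta>))"


text \<open>The de Rham differential from weight 0 to weight 1, on coefficients.\<close>

definition de_rham :: "real poly \<Rightarrow> real poly" where
  "de_rham \<phi> = pderiv \<phi>"

definition det_deriv :: "nat \<Rightarrow> nat \<Rightarrow> nat \<Rightarrow> poly_map3" where
  "det_deriv p q r = (\<lambda>\<phi> \<psi> \<theta>.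
    det (vector
      [vector [nth_pderiv p \<phi>, nth_pderiv p \<psi>, nth_pderiv p \<theta>],
       vector [nth_pderiv q \<phi>, nth_pderiv q \<psi>, nth_pderiv q \<theta>],
       vector [nth_pderiv r \<phi>, nth_pderiv r \<psi>, nth_pderiv r \<theta>]] :: real poly ^ 3 ^ 3))"

definition Delta3 :: "real \<Rightarrow> ternary_op" where
  "Delta3 lam = Ternary lam lam lam (3 * lam + 3) (det_deriv 0 1 2)"

definition xi_coeff :: "real \<Rightarrow> nat \<Rightarrow> nat \<Rightarrow> nat \<Rightarrow> real" where
  "xi_coeff t i j l =
    (if (i, j, l) = (0, 4, 0) then - t * (3 + 2 * t)
     else if (i, j, l) = (0, 0, 4) then t * (3 + 2 * t)
     else if (i, j, l) = (3, 1, 0) then - (8 / 3) * t * (2 + 3 * t)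
     else if (i, j, l) = (3, 0, 1) then (8 / 3) * t * (2 + 3 * t)
     else if (i, j, l) = (1, 3, 0) then - (2 / 3) * t * (13 + 12 * t)
     else if (i, j, l) = (1, 0, 3) then (2 / 3) * t * (13 + 12 * t)
     else if (i, j, l) = (0, 3, 1) then (5 / 3) * (3 + 2 * t)
     else if (i, j, l) = (0, 1, 3) then - (5 / 3) * (3 + 2 * t)
     else if (i, j, l) = (2, 2, 0) then - 4 * t * (2 + 3 * t)
     else if (i, j, l) = (2, 0, 2) then 4 * t * (2 + 3 * t)
     else if (i, j, l) = (1, 2, 1) then 10 * (1 + t)
     else if (i, j, l) = (1, 1, 2) then - 10 * (1 + t)
     else 0)"

definition Xi :: "real \<Rightarrow> ternary_op" where
  "Xi t = Ternary (- t - 3 / 2) t t (t + 5 / 2) (const_diff_op 4 (xi_coeff t))"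

definition Upsilon :: ternary_op where
  "Upsilon = Ternary (- 5 / 4) (- 5 / 4) (- 5 / 4) (9 / 4)
    (\<lambda>\<phi> \<psi> \<theta>. det_deriv 0 1 5 \<phi> \<psi> \<theta> + smult (5 / 2) (det_deriv 0 2 4 \<phi> \<psi> \<theta>)
       + smult 2 (det_deriv 1 2 3 \<phi> \<psi> \<theta>))"

definition Delta_d_d_d :: ternary_op where
  "Delta_d_d_d = Ternary 0 0 0 (wt_target (Delta3 1))
    (\<lambda>\<phi> \<psi> \<theta>. op_map (Delta3 1) (de_rham \<phi>) (de_rham \<psi>) (de_rham \<theta>))"

definition Xi_d_d :: ternary_op where
  "Xi_d_d = Ternary 0 0 (- 5 / 2) (wt_target (Xi 1))
    (\<lambda>\<phi> \<psi> \<theta>. op_map (Xi 1) \<theta> (de_rham \<phi>) (de_rham \<psi>))"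

end

theory Submission
  imports Defs
begin

text \<open>
  Write \<open>a, g, t\<close> for the three weights.  Invariance under \<open>d/dx\<close> and \<open>x d/dx\<close> makes the
  coefficients of the operator constant and of total order 6, so the operator is determined by the 28
  numbers \<open>X i j l = A(x^i, x^j, x^l)(0)\<close> with \<open>i + j + l = 6\<close>.  Invariance under the fields
  \<open>x^(n+1) d/dx\<close> with \<open>n \<ge> 1\<close> is a homogeneous linear system for these numbers, with coefficients
  affine in the weights.  The task is to find the weights for which it has a nonzero solution; there
  the solution turns out to be unique up to a factor.

  If \<open>g \<noteq> 0\<close>, the relations express every \<open>X i k l\<close> through the seven edge values
  \<open>f i = X i 0 (6 - i)\<close>, and what is left is a system of relations between \<open>f 0, ..., f 6\<close> which are
  quadratic in the weights.  Its decisive consequence is that the corner values \<open>f 0\<close> and \<open>f 6\<close>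
  vanish for all weights (\<open>edge_corner_zero\<close>).  Once they are gone, the relations with \<open>i = 0\<close> are
  divisible by \<open>a\<close> and those with \<open>l = 0\<close> by \<open>t\<close>, and after division they are so sparse that the system
  can be solved according to which of \<open>a\<close> and \<open>t\<close> are zero: \<open>edge_nonzero_weights\<close> leaves only
  \<open>(a, g, t) = (-5/4, -5/4, -5/4)\<close>, \<open>edge_one_zero_weight\<close> only \<open>(0, -5/2, -5/2)\<close>, and
  \<open>edge_two_zero_weights\<close> only \<open>(0, -5, 0)\<close> and \<open>(0, -5/2, 0)\<close>, each with a one-dimensional space of
  solutions.  Unless all weights vanish, a permutation of the arguments makes the middle weight
  nonzero and lets the last one vanish only together with the first, so these cases suffice.  For
  vanishing weights the system is solved directly (\<open>zero_weights\<close>).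

  Taking the adjoint in the second argument replaces \<open>g\<close> by \<open>-5 - a - g - t\<close>.  It carries
  \<open>(0, -5/2, -5/2)\<close> to \<open>(0, 0, -5/2)\<close> and \<open>(0, -5, 0)\<close> to \<open>(0, 0, 0)\<close>, while a transposition carries
  \<open>(0, -5/2, 0)\<close> to \<open>(0, 0, -5/2)\<close>.  Comparing coefficients there identifies the operators.
\<close>

section \<open>Higher derivatives of polynomials\<close>

lemma higher_pderiv_add: "(pderiv ^^ n) (p + q) = (pderiv ^^ n) p + (pderiv ^^ n) q"
  by (induction n) (simp_all add: pderiv_add)

lemma higher_pderiv_smult: "(pderiv ^^ n) (smult c p) = smult c ((pderiv ^^ n) p)"
  by (induction n) (simp_all add: pderiv_smult)

lemma higher_pderiv_0: "(pderiv ^^ n) 0 = 0"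
  by (induction n) simp_all

lemma higher_pderiv_sum: "(pderiv ^^ n) (\<Sum>x\<in>A. f x) = (\<Sum>x\<in>A. (pderiv ^^ n) (f x))"
  by (induction A rule: infinite_finite_induct) (simp_all add: higher_pderiv_add higher_pderiv_0)

lemma smult_sum_right: "smult c (\<Sum>x\<in>A. f x) = (\<Sum>x\<in>A. smult c (f x))"
  by (induction A rule: infinite_finite_induct) (simp_all add: smult_add_right)

lemma pderiv_sum: "pderiv (\<Sum>x\<in>A. f x) = (\<Sum>x\<in>A. pderiv (f x))"
  using higher_pderiv_sum[of 1 f A] by simp

lemma higher_pderiv_comp: "(pderiv ^^ m) ((pderiv ^^ n) p) = (pderiv ^^ (m + n)) p"
  by (simp add: funpow_add)

lemma higher_pderiv_mult:
  fixes p q :: "real poly"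
  shows "(pderiv ^^ n) (p * q) =
    (\<Sum>k\<le>n. smult (n choose k) ((pderiv ^^ k) p * (pderiv ^^ (n - k)) q))"
proof (induction n)
  case 0
  show ?case by simp
next
  case (Suc n)
  let ?T = "\<lambda>j k. (pderiv ^^ j) p * (pderiv ^^ k) q"
  have "(pderiv ^^ Suc n) (p * q) =
      (\<Sum>k\<le>n. smult (n choose k) (?T (Suc k) (n - k)) + smult (n choose k) (?T k (Suc n - k)))"
    unfolding funpow.simps o_apply Suc pderiv_sum
    by (intro sum.cong refl) (simp add: pderiv_smult pderiv_mult smult_add_right Suc_diff_le mult.commute)
  also have "\<dots> = (\<Sum>k\<le>n. smult (n choose k) (?T (Suc k) (n - k)))
      + (\<Sum>k\<le>n. smult (n choose k) (?T k (Suc n - k)))"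
    by (rule sum.distrib)
  also have "(\<Sum>k\<le>n. smult (n choose k) (?T k (Suc n - k))) =
      (\<Sum>k\<le>Suc n. smult (n choose k) (?T k (Suc n - k)))"
    by simp
  also have "\<dots> = ?T 0 (Suc n) + (\<Sum>k\<le>n. smult (n choose Suc k) (?T (Suc k) (n - k)))"
    by (subst sum.atMost_Suc_shift) simp
  also have "(\<Sum>k\<le>n. smult (n choose k) (?T (Suc k) (n - k))) + \<dots> =
      ?T 0 (Suc n) + (\<Sum>k\<le>n. smult (Suc n choose Suc k) (?T (Suc k) (n - k)))"
    by (simp add: smult_add_left sum.distrib)
  also have "\<dots> = (\<Sum>k\<le>Suc n. smult (Suc n choose k) (?T k (Suc n - k)))"
    by (simp add: sum.atMost_Suc_shift del: sum.atMost_Suc binomial_Suc_Suc funpow.simps(2))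
  finally show ?case .
qed

lemma finite_triples_le: "finite {(i, j, l). i + j + l \<le> (k::nat)}"
  by (rule finite_subset[of _ "{..k} \<times> {..k} \<times> {..k}"]) auto

lemma finite_triples: "finite {(i, j, l). i + j + l = (k::nat)}"
  by (rule finite_subset[OF _ finite_triples_le[of k]]) auto

lemma pderiv_linear_power:
  "pderiv ([:- c, 1:] ^ n) = smult (of_nat n) ([:- c, 1:] ^ (n - 1))"
proof (cases n)
  case (Suc m)
  show ?thesis
    unfolding Suc by (subst pderiv_power_Suc) (simp add: pderiv_pCons)
qed simp

lemma higher_pderiv_linear_power:
  fixes c :: real
  shows "(pderiv ^^ k) ([:- c, 1:] ^ n) =
    smult (if k \<le> n then fact n / fact (n - k) else 0) ([:- c, 1:] ^ (n - k))"
proof (induction k)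
  case (Suc k)
  show ?case
  proof (cases "k < n")
    case True
    then have "fact (n - k) = real (n - k) * fact (n - Suc k)"
      using fact_reduce[of "n - k", where 'a = real] by (simp add: Suc_diff_Suc)
    with True show ?thesis
      by (simp add: Suc pderiv_smult pderiv_linear_power)
  qed (simp add: Suc pderiv_smult pderiv_linear_power)
qed simp

lemma lie_derivative_linear_power:
  "lie_derivative lam ([:- c, 1:] ^ n) ([:- c, 1:] ^ i) =
     smult (i + n * lam) ([:- c, 1:] ^ (i + n - 1))"
proof -
  have "[:- c, 1:] ^ n * smult (of_nat i) ([:- c, 1:] ^ (i - 1)) = smult (of_nat i) ([:- c, 1:] ^ (i + n - 1))"
  proof (cases i)
    case (Suc m)
    then show ?thesis by (simp only: mult_smult_right power_add[symmetric]) (simp add: add.commute)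
  qed simp
  moreover have "smult (of_nat n) ([:- c, 1:] ^ (n - 1)) * [:- c, 1:] ^ i = smult (of_nat n) ([:- c, 1:] ^ (i + n - 1))"
  proof (cases n)
    case (Suc m)
    then show ?thesis by (simp only: mult_smult_left power_add[symmetric]) (simp add: add.commute)
  qed simp
  ultimately show ?thesis
    unfolding lie_derivative_def pderiv_linear_power by (simp add: smult_add_left mult.commute)
qed

section \<open>Invariance as a system of linear relations\<close>

definition poly_diff_op :: "nat \<Rightarrow> (nat \<Rightarrow> nat \<Rightarrow> nat \<Rightarrow> real poly) \<Rightarrow> poly_map3" where
  "poly_diff_op k p = (\<lambda>\<phi> \<psi> \<theta>. \<Sum>(i, j, l) \<in> {(i, j, l). i + j + l \<le> k}.
     p i j l * nth_pderiv i \<phi> * nth_pderiv j \<psi> * nth_pderiv l \<theta>)"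

lemma poly_diff_op_smult:
  "poly_diff_op k p (smult r \<phi>) \<psi> \<theta> = smult r (poly_diff_op k p \<phi> \<psi> \<theta>)"
  "poly_diff_op k p \<phi> (smult r \<psi>) \<theta> = smult r (poly_diff_op k p \<phi> \<psi> \<theta>)"
  "poly_diff_op k p \<phi> \<psi> (smult r \<theta>) = smult r (poly_diff_op k p \<phi> \<psi> \<theta>)"
  by (simp_all add: poly_diff_op_def higher_pderiv_smult smult_sum_right case_prod_unfold)

text \<open>
  At the point \<open>c\<close> the powers of \<open>x - c\<close> are dual to the derivatives, so evaluating the operator on
  them isolates a single coefficient.
\<close>

lemma poly_poly_diff_op_linear_powers:
  "poly (poly_diff_op k p ([:- c, 1:] ^ i) ([:- c, 1:] ^ j) ([:- c, 1:] ^ l)) c =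
    (if i + j + l \<le> k then fact i * fact j * fact l * poly (p i j l) c else 0)"
proof -
  have d: "poly (nth_pderiv m ([:- c, 1:] ^ n)) c = (if m = n then fact n else 0)" for m n
    by (auto simp: higher_pderiv_linear_power poly_power)
  have "poly (poly_diff_op k p ([:- c, 1:] ^ i) ([:- c, 1:] ^ j) ([:- c, 1:] ^ l)) c =
     (\<Sum>x \<in> {(i, j, l). i + j + l \<le> k}. if x = (i, j, l) then fact i * fact j * fact l * poly (p i j l) c else 0)"
    unfolding poly_diff_op_def poly_sum
    by (intro sum.cong refl) (auto simp: d split: if_splits)
  also have "\<dots> = (if i + j + l \<le> k then fact i * fact j * fact l * poly (p i j l) c else 0)"
    by (subst sum.delta[OF finite_triples_le]) auto
  finally show ?thesis .
qed

text \<open>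
  A field \<open>(x - c)^n d/dx\<close> maps a power of \<open>x - c\<close> to a multiple of another power, so invariance
  becomes a relation between the values \<open>J\<close> of the operator on such powers at \<open>c\<close>.  For \<open>n = 1\<close> it is
  the Euler field, which kills the coefficients of total order below \<open>k\<close>; \<open>n = 0\<close> then shows that those
  of order \<open>k\<close> have derivative zero; the fields with \<open>n \<ge> 2\<close> vanish to second order at \<open>c\<close>, so that
  the left-hand side of the invariance condition disappears.
\<close>

lemma invariant_poly_diff_op:
  fixes a g t :: real
  assumes inv: "vect1_invariant (Ternary a g t (a + g + t + k) (poly_diff_op k p))"
  obtains X where
    "poly_diff_op k p = const_diff_op k (\<lambda>i j l. X i j l / (fact i * fact j * fact l))"
    "\<And>n i j l. 1 \<le> n \<Longrightarrow> i + j + l + n = k \<Longrightarrow>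
       (i + (n + 1) * a) * X (i + n) j l + (j + (n + 1) * g) * X i (j + n) l
       + (l + (n + 1) * t) * X i j (l + n) = 0"
    "\<And>i j l. i + j + l = k \<Longrightarrow> p i j l = [:X i j l / (fact i * fact j * fact l):]"
proof -
  let ?F = "poly_diff_op k p"
  let ?M = "\<lambda>c n. [:- c, 1:] ^ n :: real poly"
  define J where "J c i j l = poly (?F (?M c i) (?M c j) (?M c l)) c" for c i j l
  have J: "J c i j l = (if i + j + l \<le> k then fact i * fact j * fact l * poly (p i j l) c else 0)" for c i j l
    unfolding J_def by (rule poly_poly_diff_op_linear_powers)
  have L: "lie_derivative (a + g + t + k) (?M c n) (?F (?M c i) (?M c j) (?M c l)) =
      smult (i + n * a) (?F (?M c (i + n - 1)) (?M c j) (?M c l)) +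
      smult (j + n * g) (?F (?M c i) (?M c (j + n - 1)) (?M c l)) +
      smult (l + n * t) (?F (?M c i) (?M c j) (?M c (l + n - 1)))" for c n i j l
    using inv unfolding vect1_invariant_def
    by (simp add: lie_derivative_linear_power poly_diff_op_smult)
  have L': "poly (lie_derivative (a + g + t + k) (?M c n) (?F (?M c i) (?M c j) (?M c l))) c =
      (i + n * a) * J c (i + n - 1) j l + (j + n * g) * J c i (j + n - 1) l + (l + n * t) * J c i j (l + n - 1)"
    for c n i j l
    unfolding L by (simp add: J_def)
  have low: "p i j l = 0" if "i + j + l < k" for i j l
  proof -
    have "poly (p i j l) c = 0" for c
    proof -
      have "(a + g + t + k) * J c i j l = (i + a) * J c i j l + (j + g) * J c i j l + (l + t) * J c i j l"
        using L'[of c 1 i j l] by (simp add: lie_derivative_def pderiv_pCons J_def)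
      then have "(real k - (i + j + l)) * J c i j l = 0" by (simp add: algebra_simps)
      moreover have "real k - (i + j + l) \<noteq> 0" using that by linarith
      ultimately show ?thesis using that by (simp add: J)
    qed
    then show ?thesis using poly_all_0_iff_0 by blast
  qed
  have J0: "J c i j l = 0" if "i + j + l < k" for i j l c
    using low[OF that] by (simp add: J)
  define X where "X i j l = J 0 i j l" for i j l
  have const: "p i j l = [:X i j l / (fact i * fact j * fact l):]" if s: "i + j + l = k" for i j l
  proof -
    have F: "?F (?M c i) (?M c j) (?M c l) = smult (fact i * fact j * fact l) (p i j l)" for c
    proof -
      have "?F (?M c i) (?M c j) (?M c l) = (\<Sum>x \<in> {(i, j, l). i + j + l \<le> k}.
          if x = (i, j, l) then smult (fact i * fact j * fact l) (p i j l) else 0)"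
        unfolding poly_diff_op_def
      proof (intro sum.cong refl, clarify)
        fix i' j' l' assume "i' + j' + l' \<le> k"
        show "p i' j' l' * nth_pderiv i' (?M c i) * nth_pderiv j' (?M c j) * nth_pderiv l' (?M c l) =
          (if (i', j', l') = (i, j, l) then smult (fact i * fact j * fact l) (p i j l) else 0)"
        proof (cases "i' + j' + l' < k")
          case True
          then show ?thesis using low[OF True] s by auto
        next
          case False
          then have "(i', j', l') = (i, j, l) \<or> i < i' \<or> j < j' \<or> l < l'"
            using s \<open>i' + j' + l' \<le> k\<close> by auto
          then show ?thesis by (auto simp: higher_pderiv_linear_power mult.commute mult.left_commute)
        qed
      qed
      also have "\<dots> = smult (fact i * fact j * fact l) (p i j l)"
        using s by (subst sum.delta[OF finite_triples_le]) auto
      finally show ?thesis .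
    qed
    have "poly (pderiv (p i j l)) c = 0" for c
    proof -
      have "i * J c (i - 1) j l = 0" "j * J c i (j - 1) l = 0" "l * J c i j (l - 1) = 0"
        using s J0[of "i - 1" j l c] J0[of i "j - 1" l c] J0[of i j "l - 1" c]
        by (cases i; cases j; cases l; simp)+
      then have "poly (pderiv (?F (?M c i) (?M c j) (?M c l))) c = 0"
        using L'[of c 0 i j l] by (auto simp: lie_derivative_def)
      then show ?thesis by (simp add: F pderiv_smult)
    qed
    then have "pderiv (p i j l) = 0" using poly_all_0_iff_0 by blast
    then obtain r where "p i j l = [:r:]" using pderiv_iszero by blast
    then show ?thesis using J[of 0 i j l] s by (simp add: X_def)
  qed
  show ?thesis
  proof
    show "?F = const_diff_op k (\<lambda>i j l. X i j l / (fact i * fact j * fact l))"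
    proof (intro ext)
      fix \<phi> \<psi> \<theta>
      have "?F \<phi> \<psi> \<theta> = (\<Sum>(i, j, l) \<in> {(i, j, l). i + j + l = k}.
          p i j l * nth_pderiv i \<phi> * nth_pderiv j \<psi> * nth_pderiv l \<theta>)"
        unfolding poly_diff_op_def
        by (rule sum.mono_neutral_right[OF finite_triples_le]) (auto simp: order.order_iff_strict low)
      also have "\<dots> = const_diff_op k (\<lambda>i j l. X i j l / (fact i * fact j * fact l)) \<phi> \<psi> \<theta>"
        unfolding const_diff_op_def by (intro sum.cong refl) (auto simp: const mult.assoc)
      finally show "?F \<phi> \<psi> \<theta> = const_diff_op k (\<lambda>i j l. X i j l / (fact i * fact j * fact l)) \<phi> \<psi> \<theta>" .
    qed
    show "(i + (n + 1) * a) * X (i + n) j l + (j + (n + 1) * g) * X i (j + n) l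
       + (l + (n + 1) * t) * X i j (l + n) = 0" if "1 \<le> n" "i + j + l + n = k" for n i j l
    proof -
      have "poly (lie_derivative r (?M 0 (n + 1)) q) 0 = 0" for r q
        unfolding lie_derivative_def pderiv_linear_power using that(1) by (simp add: poly_power)
      then show ?thesis
        using L'[of 0 "n + 1" i j l] by (simp add: X_def add.commute)
    qed
    show "p i j l = [:X i j l / (fact i * fact j * fact l):]" if "i + j + l = k" for i j l
      by (rule const[OF that])
  qed
qed

text \<open>
  The relation for the field \<open>x^(n+1) d/dx\<close> applied to \<open>x^i, x^j, x^l\<close>, for operators of order 6 with
  weights \<open>a, g, t\<close>; here \<open>X i j l\<close> is the value at 0 of the operator on monomials.
\<close>

definition vect_relations :: "real \<Rightarrow> real \<Rightarrow> real \<Rightarrow> (nat \<Rightarrow> nat \<Rightarrow> nat \<Rightarrow> real) \<Rightarrow> bool" where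
  "vect_relations a g t X \<longleftrightarrow> (\<forall>n i j l. 1 \<le> n \<longrightarrow> i + j + l + n = 6 \<longrightarrow>
     (i + (n + 1) * a) * X (i + n) j l + (j + (n + 1) * g) * X i (j + n) l
       + (l + (n + 1) * t) * X i j (l + n) = 0)"

lemma vect_relationsD:
  assumes "vect_relations a g t X" "1 \<le> n" "i + j + l + n = 6"
  shows "(i + (n + 1) * a) * X (i + n) j l + (j + (n + 1) * g) * X i (j + n) l
       + (l + (n + 1) * t) * X i j (l + n) = 0"
  using assms unfolding vect_relations_def by blast

lemma vect_relations_swap12:
  assumes "vect_relations a g t X"
  shows "vect_relations g a t (\<lambda>i j l. X j i l)"
  unfolding vect_relations_def
proof (intro allI impI)
  fix n i j l :: nat
  assume "1 \<le> n" "i + j + l + n = 6"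
  then show "(i + (n + 1) * g) * X j (i + n) l + (j + (n + 1) * a) * X (j + n) i l
       + (l + (n + 1) * t) * X j i (l + n) = 0"
    using vect_relationsD[OF assms, of n j i l] by (simp add: ac_simps)
qed

lemma vect_relations_swap23:
  assumes "vect_relations a g t X"
  shows "vect_relations a t g (\<lambda>i j l. X i l j)"
  unfolding vect_relations_def
proof (intro allI impI)
  fix n i j l :: nat
  assume "1 \<le> n" "i + j + l + n = 6"
  then show "(i + (n + 1) * a) * X (i + n) l j + (j + (n + 1) * t) * X i l (j + n)
       + (l + (n + 1) * g) * X i (l + n) j = 0"
    using vect_relationsD[OF assms, of n i l j] by (simp add: ac_simps)
qed

section \<open>Reduction to an edge\<close>

text \<open>
  The coefficient \<open>j + (n + 1) * g\<close> is \<open>(n + 1) * g\<close> for \<open>j = 0\<close>.  So, up to the factor \<open>g\<close>, the values off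
  the edge \<open>j = 0\<close> are combinations of two values on it.
\<close>

lemma off_edge:
  assumes "vect_relations a g t X" "1 \<le> k" "i + k + l = 6"
  shows "(k + 1) * (g * X i k l) = - ((i + (k + 1) * a) * X (i + k) 0 l + (l + (k + 1) * t) * X i 0 (l + k))"
  using vect_relationsD[OF assms(1,2), of i 0 l] assms(3) by (simp add: algebra_simps)

text \<open>
  This is what the relation with indices \<open>n, i, j, l\<close> becomes when it is multiplied by
  \<open>- (j + 1) * (j + n + 1) * g\<close> and its three terms are rewritten by \<open>off_edge\<close>.
\<close>

definition edge_form :: "real \<Rightarrow> real \<Rightarrow> real \<Rightarrow> (nat \<Rightarrow> real) \<Rightarrow> nat \<Rightarrow> nat \<Rightarrow> nat \<Rightarrow> nat \<Rightarrow> real" where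
  "edge_form a g t f n i j l =
     (j + n + 1) * (i + (n + 1) * a) * ((i + n + (j + 1) * a) * f (i + j + n) + (l + (j + 1) * t) * f (i + n))
   + (j + 1) * (j + (n + 1) * g) * ((i + (j + n + 1) * a) * f (i + j + n) + (l + (j + n + 1) * t) * f i)
   + (j + n + 1) * (l + (n + 1) * t) * ((i + (j + 1) * a) * f (i + j) + (l + n + (j + 1) * t) * f i)"

definition edge_relations :: "real \<Rightarrow> real \<Rightarrow> real \<Rightarrow> (nat \<Rightarrow> real) \<Rightarrow> bool" where
  "edge_relations a g t f \<longleftrightarrow>
     (\<forall>n i j l. 1 \<le> n \<longrightarrow> 1 \<le> j \<longrightarrow> i + j + l + n = 6 \<longrightarrow> edge_form a g t f n i j l = 0)"

lemmas edge_form_eval = edge_form_def numeral_2_eq_2[symmetric]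

lemma edge_relationsD:
  assumes "edge_relations a g t f" "1 \<le> n" "1 \<le> j" "i + j + l + n = 6"
  shows "edge_form a g t f n i j l = 0"
  using assms unfolding edge_relations_def by blast

lemma edge_relations_of_vect_relations:
  assumes X: "vect_relations a g t X"
  shows "edge_relations a g t (\<lambda>i. X i 0 (6 - i))"
  unfolding edge_relations_def
proof (intro allI impI)
  fix n i j l :: nat
  assume n: "1 \<le> n" and j: "1 \<le> j" and s: "i + j + l + n = 6"
  have e: "(i + (n + 1) * a) * X (i + n) j l + (j + (n + 1) * g) * X i (j + n) l
       + (l + (n + 1) * t) * X i j (l + n) = 0"
    by (rule vect_relationsD[OF X n s])
  have u: "6 - (i + j + n) = l" "6 - (i + n) = l + j" "6 - (i + j) = l + n" "6 - i = l + j + n"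
    using s by auto
  have e1: "(j + 1) * (g * X (i + n) j l) = - ((i + n + (j + 1) * a) * X (i + j + n) 0 l + (l + (j + 1) * t) * X (i + n) 0 (l + j))"
    using off_edge[OF X j, of "i + n" l] s by (simp add: ac_simps)
  have e2: "(j + n + 1) * (g * X i (j + n) l) = - ((i + (j + n + 1) * a) * X (i + j + n) 0 l + (l + (j + n + 1) * t) * X i 0 (l + j + n))"
    using off_edge[OF X, of "j + n" i l] s j by (simp add: ac_simps)
  have e3: "(j + 1) * (g * X i j (l + n)) = - ((i + (j + 1) * a) * X (i + j) 0 (l + n) + (l + n + (j + 1) * t) * X i 0 (l + j + n))"
    using off_edge[OF X j, of i "l + n"] s by (simp add: ac_simps)
  have "edge_form a g t (\<lambda>i. X i 0 (6 - i)) n i j l =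
      - ((j + n + 1) * (i + (n + 1) * a) * ((j + 1) * (g * X (i + n) j l))
       + (j + 1) * (j + (n + 1) * g) * ((j + n + 1) * (g * X i (j + n) l))
       + (j + n + 1) * (l + (n + 1) * t) * ((j + 1) * (g * X i j (l + n))))"
    unfolding e1 e2 e3 edge_form_def u by (simp add: algebra_simps)
  also have "\<dots> = - ((j + 1) * (j + n + 1) * g * ((i + (n + 1) * a) * X (i + n) j l + (j + (n + 1) * g) * X i (j + n) l
       + (l + (n + 1) * t) * X i j (l + n)))"
    by (simp add: algebra_simps)
  finally show "edge_form a g t (\<lambda>i. X i 0 (6 - i)) n i j l = 0"
    using e by simp
qed

text \<open>
  Exchanging the first and the last argument reverses the edge.
\<close>

lemma edge_relations_swap:
  assumes "edge_relations a g t f"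
  shows "edge_relations t g a (\<lambda>i. f (6 - i))"
  unfolding edge_relations_def
proof (intro allI impI)
  fix n i j l :: nat
  assume n: "1 \<le> n" and j: "1 \<le> j" and s: "i + j + l + n = 6"
  have u: "6 - (i + j + n) = l" "6 - (i + n) = l + j" "6 - (i + j) = l + n" "6 - i = l + j + n"
    using s by auto
  have "edge_form t g a (\<lambda>i. f (6 - i)) n i j l = edge_form a g t f n l j i"
    unfolding edge_form_def u by (simp add: ac_simps)
  moreover have "edge_form a g t f n l j i = 0"
    using assms n j s unfolding edge_relations_def by (simp add: ac_simps)
  ultimately show "edge_form t g a (\<lambda>i. f (6 - i)) n i j l = 0" by simp
qed

section \<open>The corners of the edge vanish\<close>

text \<open>
  The next four identities are polynomial identities in the weights and the edge values.  Their
  right-hand sides are combinations of the edge relations, with multipliers obtained by linear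
  algebra over the monomials in the weights.  With \<open>d = - 5 - a - g - t\<close>, the weight that the adjoints
  exchange with the other three, the first two yield \<open>(t + d + 1) * f 0 = 0\<close> and \<open>t * d * f 0 = 0\<close>.
  Hence \<open>f 0 \<noteq> 0\<close> leaves only \<open>t = 0\<close> and \<open>t = - 1\<close> with \<open>a + g = - 4\<close>, and the last two identities
  exclude these two lines.
\<close>

lemma corner_sum_identity:
  fixes f :: "nat \<Rightarrow> real"
  shows "1960 * ((a + g + 4) * f 0) =
       (13860 * t + 3290) * edge_form a g t f 1 0 1 4
     + (1512 * a - 252 * g - 4788 * t - 1848) * edge_form a g t f 1 0 3 2
     + (-2520 * a + 2520 * g - 3780) * edge_form a g t f 1 0 4 1
     + (1080 * a + 120) * edge_form a g t f 1 0 5 0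
     + (-2100 * a) * edge_form a g t f 1 1 2 2
     + (-1680 * a) * edge_form a g t f 1 1 4 0
     + (-2520 * a) * edge_form a g t f 1 2 2 1
     + (15120 * a) * edge_form a g t f 1 3 1 1
     + (420 * a) * edge_form a g t f 1 3 2 0
     + (-224 * a + 224 * g + 560 * t + 336) * edge_form a g t f 2 0 2 2
     + (420 * a - 2100 * g - 420) * edge_form a g t f 2 0 3 1
     + (-240 * a + 144 * g - 64) * edge_form a g t f 2 0 4 0
     + (140 * a) * edge_form a g t f 2 1 3 0
     + (224 * a) * edge_form a g t f 2 2 2 0
     + (45 * a - 135 * g - 30) * edge_form a g t f 3 0 3 0"
  by (simp add: edge_form_eval algebra_simps)

lemma corner_product_identity:
  fixes f :: "nat \<Rightarrow> real"
  shows "1176 * (t * (a + g + t + 5) * f 0) =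
       (420 * t) * edge_form a g t f 1 0 1 4
     + (-420 * t) * edge_form a g t f 1 0 2 3
     + (-36) * edge_form a g t f 1 0 5 0
     + (-168 * a) * edge_form a g t f 1 1 4 0
     + (252 * a) * edge_form a g t f 1 2 3 0
     + (112 * t) * edge_form a g t f 2 0 2 2
     + (48 * a - 48 * g + 40) * edge_form a g t f 2 0 4 0
     + (140 * a) * edge_form a g t f 2 1 3 0
     + (-224 * a) * edge_form a g t f 2 2 2 0
     + (-45 * a + 45 * g) * edge_form a g t f 3 0 3 0"
  by (simp add: edge_form_eval algebra_simps)

lemma corner_identity_weight_0:
  fixes f :: "nat \<Rightarrow> real"
  assumes "g = - 4 - a" "t = 0"
  shows "1008 * f 0 =
       (162 * a + 87) * edge_form a g t f 1 0 1 4
     + (548 * a + 280) * edge_form a g t f 1 0 2 3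
     + (-1926 * a - 450) * edge_form a g t f 1 0 3 2
     + (1836 * a + 270) * edge_form a g t f 1 0 4 1
     + (-1088 * a) * edge_form a g t f 1 1 1 3
     + (3402 * a) * edge_form a g t f 1 1 2 2
     + (-2916 * a) * edge_form a g t f 1 1 3 1"
  unfolding assms by (simp add: edge_form_eval algebra_simps)

lemma corner_identity_weight_minus_1:
  fixes f :: "nat \<Rightarrow> real"
  assumes "g = - 4 - a" "t = - 1"
  shows "1008 * f 0 =
       (3174 * a + 2107) * edge_form a g t f 1 0 1 4
     + (-7280 * a - 2080) * edge_form a g t f 1 0 2 3
     + (6174 * a + 1170) * edge_form a g t f 1 0 3 2
     + (-1836 * a - 270) * edge_form a g t f 1 0 4 1
     + (16640 * a) * edge_form a g t f 1 1 1 3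
     + (-11178 * a) * edge_form a g t f 1 1 2 2
     + (2916 * a) * edge_form a g t f 1 1 3 1"
  unfolding assms by (simp add: edge_form_eval algebra_simps)

lemma edge_corner_zero:
  assumes f: "edge_relations a g t f"
  shows "f 0 = 0"
proof (rule ccontr)
  assume nz: "f 0 \<noteq> 0"
  note e = edge_relationsD[OF f]
  have "(a + g + 4) * f 0 = 0"
    using corner_sum_identity[of a g f t] by (simp add: e)
  with nz have g: "g = - 4 - a" by simp
  have "t * (a + g + t + 5) * f 0 = 0"
    using corner_product_identity[of t a g f] by (simp add: e)
  with nz g have "t = 0 \<or> t = - 1" by auto
  then show False
  proof
    assume "t = 0"
    have "1008 * f 0 = 0"
      unfolding corner_identity_weight_0[OF g \<open>t = 0\<close>] by (simp add: e)
    with nz show False by simp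
  next
    assume "t = - 1"
    have "1008 * f 0 = 0"
      unfolding corner_identity_weight_minus_1[OF g \<open>t = - 1\<close>] by (simp add: e)
    with nz show False by simp
  qed
qed

lemma edge_corner_zero':
  assumes "edge_relations a g t f"
  shows "f 6 = 0"
  using edge_corner_zero[OF edge_relations_swap[OF assms]] by simp

section \<open>Solutions of the edge relations\<close>

text \<open>
  Since \<open>f 0\<close> and \<open>f 6\<close> vanish, every term of the edge relation with \<open>n = 1\<close> and \<open>i = 0\<close> contains the
  factor \<open>a\<close>.  Dividing by it gives one relation for each \<open>j\<close> from 1 to 5.
\<close>

lemma edge_side:
  assumes f: "edge_relations a g t f" and a: "a \<noteq> 0"
  shows "t = 0 \<or> f 5 = - f 1"
    and "(1 + a + g) * f 2 + 2 * (2 + t) * f 1 = 0"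
    and "2 * (4 + 3 * a + 3 * g) * f 3 + 3 * (3 + 2 * t) * f 2 + 6 * (1 + t) * f 1 = 0"
    and "(7 + 4 * a + 4 * g) * f 4 + 4 * (1 + t) * f 3 + 2 * (1 + 2 * t) * f 1 = 0"
    and "2 * (11 + 5 * a + 5 * g) * f 5 + 5 * (1 + 2 * t) * f 4 + 2 * (1 + 5 * t) * f 1 = 0"
proof -
  note e = edge_relationsD[OF f, of 1 _ 0]
  have z: "f 0 = 0" "f 6 = 0" using edge_corner_zero[OF f] edge_corner_zero'[OF f] by auto
  have "edge_form a g t f 1 0 5 0 = 84 * a * t * (f 5 + f 1)"
    using z by (simp add: edge_form_eval algebra_simps)
  then show "t = 0 \<or> f 5 = - f 1" using e[of 5 0] a by auto
  have "edge_form a g t f 1 0 1 4 = 12 * a * ((1 + a + g) * f 2 + 2 * (2 + t) * f 1)"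
    using z by (simp add: edge_form_eval algebra_simps)
  then show "(1 + a + g) * f 2 + 2 * (2 + t) * f 1 = 0" using e[of 1 4] a by simp
  have "edge_form a g t f 1 0 2 3 = 4 * a * (2 * (4 + 3 * a + 3 * g) * f 3 + 3 * (3 + 2 * t) * f 2 + 6 * (1 + t) * f 1)"
    using z by (simp add: edge_form_eval algebra_simps)
  then show "2 * (4 + 3 * a + 3 * g) * f 3 + 3 * (3 + 2 * t) * f 2 + 6 * (1 + t) * f 1 = 0"
    using e[of 2 3] a by simp
  have "edge_form a g t f 1 0 3 2 = 10 * a * ((7 + 4 * a + 4 * g) * f 4 + 4 * (1 + t) * f 3 + 2 * (1 + 2 * t) * f 1)"
    using z by (simp add: edge_form_eval algebra_simps)
  then show "(7 + 4 * a + 4 * g) * f 4 + 4 * (1 + t) * f 3 + 2 * (1 + 2 * t) * f 1 = 0"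
    using e[of 3 2] a by simp
  have "edge_form a g t f 1 0 4 1 = 6 * a * (2 * (11 + 5 * a + 5 * g) * f 5 + 5 * (1 + 2 * t) * f 4 + 2 * (1 + 5 * t) * f 1)"
    using z by (simp add: edge_form_eval algebra_simps)
  then show "2 * (11 + 5 * a + 5 * g) * f 5 + 5 * (1 + 2 * t) * f 4 + 2 * (1 + 5 * t) * f 1 = 0"
    using e[of 4 1] a by simp
qed

text \<open>
  For nonzero \<open>a\<close> and \<open>t\<close> the relations of \<open>edge_side\<close> hold from both ends and are triangular enough to
  be solved by hand, starting from \<open>u = f 1 = - f 5\<close>.  If \<open>u \<noteq> 0\<close>, eliminating \<open>f 2\<close> (and likewise
  \<open>f 4\<close>) from its two equations gives \<open>(g - a) * (a + g + t + 3) = 0\<close> and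
  \<open>(g - t) * (a + g + t + 3) = 0\<close>.  The second factor cannot vanish, so all weights agree, and one
  further elimination fixes their common value.
\<close>

lemma edge_nonzero_weights:
  assumes f: "edge_relations a g t f" and a: "a \<noteq> 0" and t: "t \<noteq> 0"
    and nz: "f i \<noteq> 0" "i \<le> 6"
  shows "a = - 5 / 4 \<and> g = - 5 / 4 \<and> t = - 5 / 4 \<and>
    f 0 = 0 \<and> f 2 = f 1 \<and> f 3 = 0 \<and> f 4 = - f 1 \<and> f 5 = - f 1 \<and> f 6 = 0"
proof -
  define u where "u = f 1"
  have z: "f 0 = 0" "f 6 = 0" using edge_corner_zero[OF f] edge_corner_zero'[OF f] by auto
  have f5: "f 5 = - u" using edge_side(1)[OF f a] t by (simp add: u_def)
  \<comment> \<open>The facts A come from the end \<open>i = 0\<close> of the edge, the facts B from the other end.\<close>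
  have A1: "(1 + a + g) * f 2 + 2 * (2 + t) * u = 0"
    and A2: "2 * (4 + 3 * a + 3 * g) * f 3 + 3 * (3 + 2 * t) * f 2 + 6 * (1 + t) * u = 0"
    and A3: "(7 + 4 * a + 4 * g) * f 4 + 4 * (1 + t) * f 3 + 2 * (1 + 2 * t) * u = 0"
    and A4: "(1 + 2 * t) * f 4 = 2 * (2 + a + g - t) * u"
    using edge_side(2-5)[OF f a] f5 by (simp_all add: u_def algebra_simps)
  have B1: "(1 + t + g) * f 4 - 2 * (2 + a) * u = 0"
    and B2: "2 * (4 + 3 * t + 3 * g) * f 3 + 3 * (3 + 2 * a) * f 4 - 6 * (1 + a) * u = 0"
    and B3: "(7 + 4 * t + 4 * g) * f 2 + 4 * (1 + a) * f 3 - 2 * (1 + 2 * a) * u = 0"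
    and B4: "(1 + 2 * a) * f 2 = - 2 * (2 + t + g - a) * u"
    using edge_side(2-5)[OF edge_relations_swap[OF f] t] f5 by (simp_all add: u_def algebra_simps)
  \<comment> \<open>If \<open>u = 0\<close>, the two equations that contain \<open>f 2\<close> alone fix \<open>a\<close> and \<open>g\<close> unless \<open>f 2\<close> vanishes, and
      the others then fail.  The same happens for \<open>f 4\<close>, and afterwards for \<open>f 3\<close>.\<close>
  have u: "u \<noteq> 0"
  proof
    assume u0: "u = 0"
    have f2: "f 2 = 0"
    proof (rule ccontr)
      assume n: "f 2 \<noteq> 0"
      have w: "a = - 1 / 2" "g = - 1 / 2" using A1 B4 u0 n by auto
      have e: "2 * f 3 + 3 * (3 + 2 * t) * f 2 = 0" "(5 + 4 * t) * f 2 + 2 * f 3 = 0"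
        using A2 B3 u0 w by (auto simp: algebra_simps)
      then have "(t + 2) * f 2 = 0" by (simp add: algebra_simps)
      then have t2: "t = - 2" using n by simp
      then have "f 4 = 0" using A4 u0 by simp
      then have "f 3 = 0" using A3 u0 w t2 by simp
      then show False using e t2 n by simp
    qed
    have f4: "f 4 = 0"
    proof (rule ccontr)
      assume n: "f 4 \<noteq> 0"
      have w: "t = - 1 / 2" "g = - 1 / 2" using B1 A4 u0 n by auto
      have e: "2 * f 3 + 3 * (3 + 2 * a) * f 4 = 0" "(5 + 4 * a) * f 4 + 2 * f 3 = 0"
        using B2 A3 u0 w by (auto simp: algebra_simps)
      then have "(a + 2) * f 4 = 0" by (simp add: algebra_simps)
      then have a2: "a = - 2" using n by simp
      then have "f 3 = 0" using B3 u0 f2 by simp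
      then show False using e a2 n by simp
    qed
    have f3: "f 3 = 0"
    proof (rule ccontr)
      assume n: "f 3 \<noteq> 0"
      have w: "a = - 1" "t = - 1" using A3 B3 u0 f2 f4 n by auto
      have g: "g = - 1 / 3" using A2 u0 f2 n w by auto
      have "edge_form a g t f 1 1 1 3 = 0" by (rule edge_relationsD[OF f]) auto
      then show False using n f2 u0 by (simp add: edge_form_eval w g u_def)
    qed
    have "i = 0 \<or> i = 1 \<or> i = 2 \<or> i = 3 \<or> i = 4 \<or> i = 5 \<or> i = 6" using nz(2) by auto
    then show False using nz(1) z f2 f3 f4 f5 u0 by (auto simp: u_def)
  qed
  have "(g - a) * (a + g + t + 3) * u = 0"
    using A1 B4 by algebra
  then have ga: "g = a \<or> a + g + t = - 3" using u by auto
  have "(g - t) * (a + g + t + 3) * u = 0"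
    using B1 A4 by algebra
  then have gt: "g = t \<or> a + g + t = - 3" using u by auto
  have "a + g + t \<noteq> - 3"
  proof
    assume s: "a + g + t = - 3"
    have g: "g = - 3 - a - t" using s by simp
    have a2: "(t + 2) * (f 2 - 2 * u) = 0" "(1 + 2 * a) * (f 2 - 2 * u) = 0"
      using A1 B4 unfolding g by (simp_all add: algebra_simps)
    have t2: "(a + 2) * (f 4 + 2 * u) = 0" "(1 + 2 * t) * (f 4 + 2 * u) = 0"
      using B1 A4 unfolding g by (simp_all add: algebra_simps)
    consider "f 2 \<noteq> 2 * u" | "f 4 \<noteq> - 2 * u" | "f 2 = 2 * u" "f 4 = - 2 * u" by blast
    then show False
    proof cases
      case 1
      then have w: "t = - 2" "a = - 1 / 2" using a2 by auto
      then have f4: "f 4 = - 2 * u" using t2 by simp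
      show False using A3 B2 u unfolding g w f4 by simp
    next
      case 2
      then have w: "a = - 2" "t = - 1 / 2" using t2 by auto
      then have f2: "f 2 = 2 * u" using a2 by simp
      show False using A2 B3 u unfolding g w f2 by simp
    next
      case 3
      have e: "(1 + t) * (f 3 + 3 * u) = 0" "(1 + a) * (f 3 - 3 * u) = 0"
        using A3 B3 unfolding g 3 by (simp_all add: algebra_simps)
      have e': "(5 + 3 * t) * f 3 = (12 + 9 * t) * u" "(5 + 3 * a) * f 3 = - (12 + 9 * a) * u"
        using A2 B2 unfolding g 3 by (simp_all add: algebra_simps)
      have "t = - 1 \<or> f 3 = - 3 * u" "a = - 1 \<or> f 3 = 3 * u" using e by auto
      then show False using e' u by auto
    qed
  qed
  then have w: "a = g" "t = g" using ga gt by auto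
  have e: "(1 + 2 * g) * f 2 = - (4 + 2 * g) * u" "(1 + 2 * g) * f 4 = (4 + 2 * g) * u"
    using A1 B1 unfolding w by (simp_all add: algebra_simps)
  have g2: "1 + 2 * g \<noteq> 0"
  proof
    assume "1 + 2 * g = 0"
    moreover from this have "g = - 1 / 2" by simp
    ultimately show False using e(1) u by simp
  qed
  have "(1 + 2 * g) * (f 2 + f 4) = 0" using e by (simp add: algebra_simps)
  then have f4: "f 4 = - f 2" using g2 by simp
  have e2: "(8 + 12 * g) * f 3 + 3 * (3 + 2 * g) * f 2 + 6 * (1 + g) * u = 0"
     "(8 + 12 * g) * f 3 - 3 * (3 + 2 * g) * f 2 - 6 * (1 + g) * u = 0"
    using A2 B2 unfolding w f4 by (simp_all add: algebra_simps)
  then have e3: "(3 + 2 * g) * f 2 + 2 * (1 + g) * u = 0" "(2 + 3 * g) * f 3 = 0" by (simp_all add: algebra_simps)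
  have "(4 * g + 5) * u = 0" using e(1) e3(1) by algebra
  then have g: "g = - 5 / 4" using u by simp
  have "f 2 = u" using e(1) unfolding g by simp
  moreover have "f 3 = 0" using e3(2) unfolding g by simp
  ultimately show ?thesis using w g f4 f5 z by (simp add: u_def)
qed

text \<open>
  The following identities serve the case \<open>a = 0\<close>, \<open>t \<noteq> 0\<close>.  Besides edge relations they use the
  relations that \<open>edge_side\<close> gives at the end where the weight is \<open>t\<close>.  The first one forces
  \<open>g + t = - 5\<close> unless \<open>f 5 = 0\<close>; the others show one edge value after the other to be zero when \<open>f 5\<close> is.  The
  multipliers are again obtained by linear algebra.
\<close>

lemma edge_identity_one_zero_weight:
  fixes f :: "nat \<Rightarrow> real"
  assumes "f 0 = 0" "f 6 = 0"
  shows "5040 * ((g + t + 5) * f 5) =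
       (-720 * g - 330 * t + 720) * ((1 + g + t) * f 4 + 4 * f 5)
     + (-60 * g + 60) * edge_form 0 g t f 1 1 1 3
     + (1080 * g + 2160 * t + 2295) * edge_form 0 g t f 1 1 2 2
     + (-1530 * g - 4464 * t - 3870) * edge_form 0 g t f 1 1 3 1
     + (510 * g + 2010 * t + 1665) * edge_form 0 g t f 1 1 4 0
     + (-720 * g - 1800 * t - 1770) * edge_form 0 g t f 1 2 1 2
     + (960 * g + 2850 * t + 2775) * edge_form 0 g t f 1 2 2 1
     + (-360 * g - 1170 * t - 1095) * edge_form 0 g t f 1 2 3 0
     + (60 * g + 60 * t + 180) * edge_form 0 g t f 1 3 1 1
     + (-30 * g - 30 * t - 195) * edge_form 0 g t f 1 3 2 0
     + (288 * t) * edge_form 0 g t f 2 1 2 1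
     + (75 * g - 95 * t + 125) * edge_form 0 g t f 2 1 3 0"
  using assms by (simp add: edge_form_eval algebra_simps)

lemma edge_identities_one_zero_weight:
  fixes f :: "nat \<Rightarrow> real"
  assumes "f 0 = 0" "f 6 = 0" "f 5 = 0"
  shows
    "1050 * f 4 =
       (-230) * ((1 + g + t) * f 4 + 4 * f 5)
     + (-100) * (2 * (4 + 3 * g + 3 * t) * f 3 + 9 * f 4 + 6 * f 5)
     + (250) * ((7 + 4 * g + 4 * t) * f 2 + 4 * f 3 + 2 * f 5)
     + (-75) * edge_form 0 g t f 1 1 2 2
     + (180) * edge_form 0 g t f 1 1 3 1
     + (-75) * edge_form 0 g t f 1 1 4 0
     + (85) * edge_form 0 g t f 1 2 1 2
     + (-280) * edge_form 0 g t f 1 2 2 1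
     + (147) * edge_form 0 g t f 1 2 3 0
     + (150) * edge_form 0 g t f 1 3 1 1
     + (-75) * edge_form 0 g t f 1 3 2 0
     + (-60) * edge_form 0 g t f 2 1 2 1
     + (25) * edge_form 0 g t f 2 1 3 0
     + (-4) * edge_form 0 g t f 2 2 2 0"
    and "f 4 = 0 \<Longrightarrow> 2640 * f 3 =
       (-180) * edge_form 0 g t f 1 1 1 3
     + (285) * edge_form 0 g t f 1 1 2 2
     + (72) * edge_form 0 g t f 1 1 3 1
     + (-75) * edge_form 0 g t f 1 1 4 0
     + (180) * edge_form 0 g t f 1 2 1 2
     + (-240) * edge_form 0 g t f 1 2 2 1
     + (45) * edge_form 0 g t f 1 2 3 0
     + (180) * edge_form 0 g t f 1 3 1 1
     + (-90) * edge_form 0 g t f 1 3 2 0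
     + (-204) * edge_form 0 g t f 2 1 2 1
     + (85) * edge_form 0 g t f 2 1 3 0
     + (40) * edge_form 0 g t f 2 2 2 0"
    and "f 3 = 0 \<Longrightarrow> f 4 = 0 \<Longrightarrow> 15 * f 2 =
       (-5) * edge_form 0 g t f 1 1 1 3
     + (15) * edge_form 0 g t f 1 1 2 2
     + (-15) * edge_form 0 g t f 1 1 3 1
     + (5) * edge_form 0 g t f 1 1 4 0
     + (18) * edge_form 0 g t f 1 2 1 2
     + (-24) * edge_form 0 g t f 1 2 2 1
     + (9) * edge_form 0 g t f 1 2 3 0"
    and "f 2 = 0 \<Longrightarrow> f 3 = 0 \<Longrightarrow> f 4 = 0 \<Longrightarrow> 210 * f 1 =
       (45) * edge_form 0 g t f 1 1 1 3
     + (-60) * edge_form 0 g t f 1 1 2 2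
     + (18) * edge_form 0 g t f 1 1 3 1
     + (4) * edge_form 0 g t f 2 1 2 1"
  using assms by (simp_all add: edge_form_eval algebra_simps)

text \<open>
  For \<open>a = 0\<close> the relations from the end with weight \<open>t\<close> depend on the weights only through \<open>g + t\<close>.
  The identity above forces \<open>g + t = - 5\<close>, after which they give all edge values in terms of \<open>f 5\<close>;
  one more relation then determines \<open>t\<close>.
\<close>

lemma edge_one_zero_weight:
  assumes f: "edge_relations 0 g t f" and t: "t \<noteq> 0" and nz: "f i \<noteq> 0" "i \<le> 6"
  shows "g = - 5 / 2 \<and> t = - 5 / 2 \<and> f 0 = 0 \<and> f 6 = 0 \<and>
    22 * f 1 = 3 * f 5 \<and> 11 * f 2 = 4 * f 5 \<and> 22 * f 3 = 15 * f 5 \<and> f 4 = f 5"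
proof -
  note e = edge_relationsD[OF f]
  have z: "f 0 = 0" "f 6 = 0" using edge_corner_zero[OF f] edge_corner_zero'[OF f] by auto
  have B: "(1 + g + t) * f 4 + 4 * f 5 = 0"
     "2 * (4 + 3 * g + 3 * t) * f 3 + 9 * f 4 + 6 * f 5 = 0"
     "(7 + 4 * g + 4 * t) * f 2 + 4 * f 3 + 2 * f 5 = 0"
     "2 * (11 + 5 * g + 5 * t) * f 1 + 5 * f 2 + 2 * f 5 = 0"
    using edge_side(2-5)[OF edge_relations_swap[OF f] t] by (simp_all add: algebra_simps)
  have "f 5 \<noteq> 0"
  proof
    assume f5: "f 5 = 0"
    note I = edge_identities_one_zero_weight[OF z f5, of g t]
    have f4: "f 4 = 0" using I(1) B by (simp add: e)
    have f3: "f 3 = 0" using I(2)[OF f4] by (simp add: e)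
    have f2: "f 2 = 0" using I(3)[OF f3 f4] by (simp add: e)
    have f1: "f 1 = 0" using I(4)[OF f2 f3 f4] by (simp add: e)
    have "i = 0 \<or> i = 1 \<or> i = 2 \<or> i = 3 \<or> i = 4 \<or> i = 5 \<or> i = 6" using nz(2) by auto
    then show False using nz(1) z f1 f2 f3 f4 f5 by auto
  qed
  moreover have "(g + t + 5) * f 5 = 0"
    using edge_identity_one_zero_weight[OF z, of g t] B by (simp add: e)
  ultimately have g: "g = - 5 - t" by simp
  have f4: "f 4 = f 5" using B(1) unfolding g by simp
  have f3: "22 * f 3 = 15 * f 5" using B(2) f4 unfolding g by simp
  have f2: "11 * f 2 = 4 * f 5" using B(3) f3 unfolding g by simp
  have f1: "22 * f 1 = 3 * f 5" using B(4) f2 unfolding g by simp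
  have "edge_form 0 g t f 1 1 3 1 = 0" by (rule e) auto
  moreover define w where "w = f 5 / 22"
  have "f (Suc 0) = 3 * w" "f 2 = 8 * w" "f 3 = 15 * w" "f 4 = 22 * w" "f 5 = 22 * w"
    using f1 f2 f3 f4 by (simp_all add: w_def)
  ultimately have "(2 * t + 5) * f 5 = 0"
    using z unfolding g by (simp add: edge_form_eval algebra_simps)
  then have "t = - 5 / 2" using \<open>f 5 \<noteq> 0\<close> by simp
  then show ?thesis using g f1 f2 f3 f4 z by simp
qed

text \<open>
  For \<open>a = t = 0\<close> the system is invariant under reversal of the edge, so it splits into a symmetric
  and an antisymmetric part.  The symmetric part requires a common root of two quadratic polynomials
  in \<open>g\<close> that have none; the antisymmetric part reduces to two equations in \<open>f 1\<close> and \<open>f 2\<close> with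
  determinant proportional to \<open>(g + 5) * (2 * g + 5)\<close>.
\<close>

lemma edge_two_zero_weights:
  assumes f: "edge_relations 0 g 0 f" and nz: "f i \<noteq> 0" "i \<le> 6"
  shows "f 0 = 0 \<and> f 3 = 0 \<and> f 4 = - f 2 \<and> f 5 = - f 1 \<and> f 6 = 0 \<and>
    (g = - 5 \<and> f 2 = f 1 \<or> g = - 5 / 2 \<and> 3 * f 2 = - 2 * f 1)"
proof -
  note e = edge_relationsD[OF f]
  have z: "f 0 = 0" "f 6 = 0" using edge_corner_zero[OF f] edge_corner_zero'[OF f] by auto
  have r1: "(4 + 2 * g) * f 3 + 9 * f 2 + (21 + 6 * g) * f 1 = 0"
    using e[of 1 1 1 3] z by (simp add: edge_form_eval algebra_simps)
  have r1': "(4 + 2 * g) * f 3 + 9 * f 4 + (21 + 6 * g) * f 5 = 0"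
    using e[of 1 1 3 1] z by (simp add: edge_form_eval algebra_simps)
  have r2: "(7 + 3 * g) * f 4 + 4 * f 3 + 4 * f 2 + (18 + 6 * g) * f 1 = 0"
    using e[of 1 2 1 2] z by (simp add: edge_form_eval algebra_simps)
  have r2': "(7 + 3 * g) * f 2 + 4 * f 3 + 4 * f 4 + (18 + 6 * g) * f 5 = 0"
    using e[of 1 2 2 1] z by (simp add: edge_form_eval algebra_simps)
  have r3: "(22 + 8 * g) * (f 1 + f 5) + 5 * (f 2 + f 4) = 0"
    using e[of 1 3 1 1] z by (simp add: edge_form_eval algebra_simps)
  have r4: "(21 + 9 * g) * (f 1 + f 5) + 10 * f 3 = 0"
    using e[of 2 2 1 1] z by (simp add: edge_form_eval algebra_simps)
  have r5: "(11 + 4 * g) * (f 2 + f 4) + 12 * f 3 = 0"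
    using e[of 1 1 2 2] z by (simp add: edge_form_eval algebra_simps)
  have s: "f 2 + f 4 = - (22 + 8 * g) / 5 * (f 1 + f 5)" "f 3 = - (21 + 9 * g) / 10 * (f 1 + f 5)"
    using r3 r4 by (simp_all add: field_simps)
  have q1: "(6 * g\<^sup>2 + 40 * g + 59) * (f 1 + f 5) = 0"
    using r2 r2' s by algebra
  have q2: "(16 * g\<^sup>2 + 115 * g + 184) * (f 1 + f 5) = 0"
    using r5 s by algebra
  have "f 1 + f 5 = 0"
  proof (rule ccontr)
    assume "f 1 + f 5 \<noteq> 0"
    then have q: "6 * g\<^sup>2 + 40 * g + 59 = 0" "16 * g\<^sup>2 + 115 * g + 184 = 0"
      using q1 q2 by auto
    \<comment> \<open>Eliminating \<open>g\<^sup>2\<close> leaves \<open>25 * g + 80 = 0\<close>.\<close>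
    then have "g = - 16 / 5" by simp
    then show False using q(1) by (simp add: power2_eq_square)
  qed
  then have f5: "f 5 = - f 1" and f4: "f 4 = - f 2" and f3: "f 3 = 0"
    using s by simp_all
  have d1: "3 * f 2 + (7 + 2 * g) * f 1 = 0"
    using r1 f3 by (simp add: algebra_simps)
  have "f 1 \<noteq> 0"
  proof
    assume f1: "f 1 = 0"
    then have "f 2 = 0" using d1 by simp
    moreover have "i = 0 \<or> i = 1 \<or> i = 2 \<or> i = 3 \<or> i = 4 \<or> i = 5 \<or> i = 6" using nz(2) by auto
    ultimately show False using nz(1) z f1 f3 f4 f5 by auto
  qed
  moreover have "(g + 5) * (2 * g + 5) * f 1 = 0"
    using d1 r2 unfolding f3 f4 by algebra
  ultimately have "g = - 5 \<or> g = - 5 / 2" by auto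
  then show ?thesis using d1 f3 f4 f5 z by auto
qed

section \<open>Vanishing weights\<close>

lemma zero_face:
  assumes X: "vect_relations 0 0 0 X" and s: "j + l = 6"
  shows "X 0 j l = 0"
proof -
  note e = vect_relationsD[OF X]
  have 1: "X 0 6 0 = 0" using e[of 5 0 1 0] by simp
  have 2: "X 0 0 6 = 0" using e[of 5 0 0 1] by simp
  have 3: "X 0 5 1 + X 0 1 5 = 0" using e[of 4 0 1 1] by simp
  have 4: "2 * X 0 5 1 + X 0 2 4 = 0" using e[of 3 0 2 1] by simp
  have 5: "X 0 4 2 + 2 * X 0 1 5 = 0" using e[of 3 0 1 2] by simp
  have 6: "4 * X 0 5 1 + X 0 4 2 = 0" using e[of 1 0 4 1] by (simp add: numeral_2_eq_2[symmetric])
  have 7: "3 * X 0 5 1 + X 0 3 3 = 0" using e[of 2 0 3 1] by (simp add: numeral_2_eq_2[symmetric])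
  have "j = 0 \<or> j = 1 \<or> j = 2 \<or> j = 3 \<or> j = 4 \<or> j = 5 \<or> j = 6" using s by auto
  then show ?thesis using 1 2 3 4 5 6 7 s by (elim disjE) auto
qed

definition delta_coeff :: "nat \<Rightarrow> nat \<Rightarrow> nat \<Rightarrow> real" where
  "delta_coeff i j l =
    (if (i, j, l) \<in> {(1, 2, 3), (2, 3, 1), (3, 1, 2)} then 1
     else if (i, j, l) \<in> {(1, 3, 2), (3, 2, 1), (2, 1, 3)} then - 1 else 0)"

lemma all_triples_iff:
  "(\<forall>i j l. i + j + l = (k::nat) \<longrightarrow> P i j l) \<longleftrightarrow> (\<forall>i\<in>{..k}. \<forall>j\<in>{..k - i}. P i j (k - i - j))"
proof (intro iffI allI impI ballI)
  fix i j l assume h: "\<forall>i\<in>{..k}. \<forall>j\<in>{..k - i}. P i j (k - i - j)" and s: "i + j + l = k"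
  have "P i j (k - i - j)" using h s by auto
  moreover have "k - i - j = l" using s by simp
  ultimately show "P i j l" by simp
qed auto

lemmas triple_simps = atMost_nat_numeral atMost_Suc fact_numeral numeral_2_eq_2[symmetric]

text \<open>
  With all weights zero, the relations with one index zero do not involve the interior values, and
  they kill the boundary.  The ten interior values then satisfy ten equations of rank nine, solved by
  the coefficients of the determinant in the derivatives of orders 1, 2 and 3.
\<close>

lemma zero_weights:
  assumes X: "vect_relations 0 0 0 X"
  shows "\<forall>i j l. i + j + l = 6 \<longrightarrow> X i j l = X 1 2 3 / 12 * delta_coeff i j l * (fact i * fact j * fact l)"
proof -
  note e = vect_relationsD[OF X]
  have x: "X 0 j l = 0" if "j + l = 6" for j l by (rule zero_face[OF X that])
  have y: "X j 0 l = 0" if "j + l = 6" for j l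
    using zero_face[OF vect_relations_swap12[OF X] that] by simp
  have z: "X j l 0 = 0" if "j + l = 6" for j l
    using zero_face[OF vect_relations_swap12[OF vect_relations_swap23[OF X]] that] by simp
  have q: "X 3 1 2 + X 1 3 2 + 2 * X 1 1 4 = 0" "X 3 2 1 + 2 * X 1 4 1 + X 1 2 3 = 0" "2 * X 4 1 1 + X 2 3 1 + X 2 1 3 = 0"
    "X 4 1 1 + X 1 4 1 + X 1 1 4 = 0"
    "X 2 1 3 + X 1 2 3 + 3 * X 1 1 4 = 0" "X 2 2 2 + 2 * X 1 3 2 + 2 * X 1 2 3 = 0"
    "X 2 3 1 + 3 * X 1 4 1 + X 1 3 2 = 0" "2 * X 3 1 2 + X 2 2 2 + 2 * X 2 1 3 = 0"
    "2 * X 3 2 1 + 2 * X 2 3 1 + X 2 2 2 = 0" "3 * X 4 1 1 + X 3 2 1 + X 3 1 2 = 0"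
    using e[of 2 1 1 2] e[of 2 1 2 1] e[of 2 2 1 1] e[of 3 1 1 1] e[of 1 1 1 3] e[of 1 1 2 2] e[of 1 1 3 1]
      e[of 1 2 1 2] e[of 1 2 2 1] e[of 1 3 1 1]
    by (simp_all add: numeral_2_eq_2[symmetric])
  have w: "X 1 1 4 = 0" "X 1 4 1 = 0" "X 4 1 1 = 0" "X 2 2 2 = 0" "X 1 3 2 = - X 1 2 3" "X 2 1 3 = - X 1 2 3"
    "X 2 3 1 = X 1 2 3" "X 3 1 2 = X 1 2 3" "X 3 2 1 = - X 1 2 3"
    using q by linarith+
  show ?thesis
    unfolding all_triples_iff
    using x y z w by (simp add: triple_simps delta_coeff_def)
qed

section \<open>Permutations and adjoints in terms of coefficients\<close>

lemma const_diff_op_cong: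
  assumes "\<And>i j l. i + j + l = k \<Longrightarrow> \<alpha> i j l = \<beta> i j l"
  shows "const_diff_op k \<alpha> = const_diff_op k \<beta>"
  unfolding const_diff_op_def by (intro ext sum.cong refl) (auto simp: assms)

lemma const_diff_op_scale:
  "smult c (const_diff_op k \<alpha> \<phi> \<psi> \<theta>) = const_diff_op k (\<lambda>i j l. c * \<alpha> i j l) \<phi> \<psi> \<theta>"
  unfolding const_diff_op_def smult_sum_right by (intro sum.cong refl) auto

lemma const_diff_op_swap12:
  "const_diff_op k \<alpha> \<psi> \<phi> \<theta> = const_diff_op k (\<lambda>i j l. \<alpha> j i l) \<phi> \<psi> \<theta>"
  unfolding const_diff_op_def
  by (rule sum.reindex_bij_witness[of _ "\<lambda>(i, j, l). (j, i, l)" "\<lambda>(i, j, l). (j, i, l)"])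
    (auto simp: mult.commute)

lemma const_diff_op_swap23:
  "const_diff_op k \<alpha> \<phi> \<theta> \<psi> = const_diff_op k (\<lambda>i j l. \<alpha> i l j) \<phi> \<psi> \<theta>"
  unfolding const_diff_op_def
  by (rule sum.reindex_bij_witness[of _ "\<lambda>(i, j, l). (i, l, j)" "\<lambda>(i, j, l). (i, l, j)"])
    (auto simp: ac_simps)

text \<open>
  The factorials turn the values \<open>X i j l\<close> on monomials, in which the relations are simplest, into the
  coefficients of the operator.
\<close>

definition normalized_op :: "real \<Rightarrow> real \<Rightarrow> real \<Rightarrow> (nat \<Rightarrow> nat \<Rightarrow> nat \<Rightarrow> real) \<Rightarrow> ternary_op" where
  "normalized_op a g t X = Ternary a g t (a + g + t + 6)
     (const_diff_op 6 (\<lambda>i j l. X i j l / (fact i * fact j * fact l)))"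

lemma perm_or_dual_swap12:
  "perm_or_dual (normalized_op a g t X) (normalized_op g a t (\<lambda>i j l. X j i l))"
proof -
  let ?s = "Transposition.transpose 0 (1::nat)"
  have p: "?s permutes {0, 1, 2}" by (rule permutes_swap_id) auto
  have i: "inv ?s = ?s" by simp
  have v: "?s 0 = 1" "?s 1 = 0" "?s 2 = 2" by (auto simp: Transposition.transpose_def)
  have w: "const_diff_op 6 (\<lambda>i j l. X i j l / (fact i * fact j * fact l)) \<psi> \<phi> \<theta> =
      const_diff_op 6 (\<lambda>i j l. X j i l / (fact i * fact j * fact l)) \<phi> \<psi> \<theta>" for \<phi> \<psi> \<theta>
    unfolding const_diff_op_swap12[of _ _ \<psi> \<phi> \<theta>] by (simp add: ac_simps)
  have "normalized_op g a t (\<lambda>i j l. X j i l) = permute_op ?s (normalized_op a g t X)"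
    unfolding permute_op_def normalized_op_def i v Let_def
    by (simp add: fun_eq_iff w)
  then show ?thesis unfolding perm_or_dual_def using p by blast
qed

lemma perm_or_dual_swap23:
  "perm_or_dual (normalized_op a g t X) (normalized_op a t g (\<lambda>i j l. X i l j))"
proof -
  let ?s = "Transposition.transpose (1::nat) 2"
  have p: "?s permutes {0, 1, 2}" by (rule permutes_swap_id) auto
  have i: "inv ?s = ?s" by simp
  have v: "?s 0 = 0" "?s 1 = 2" "?s 2 = 1" by (auto simp: Transposition.transpose_def)
  have w: "const_diff_op 6 (\<lambda>i j l. X i j l / (fact i * fact j * fact l)) \<phi> \<theta> \<psi> =
      const_diff_op 6 (\<lambda>i j l. X i l j / (fact i * fact j * fact l)) \<phi> \<psi> \<theta>" for \<phi> \<psi> \<theta>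
    unfolding const_diff_op_swap23[of _ _ \<phi> \<theta> \<psi>] by (simp add: ac_simps)
  have "normalized_op a t g (\<lambda>i j l. X i l j) = permute_op ?s (normalized_op a g t X)"
    unfolding permute_op_def normalized_op_def i v Let_def
    by (simp add: fun_eq_iff w)
  then show ?thesis unfolding perm_or_dual_def using p by blast
qed

text \<open>
  The coefficients of the adjoint in the second argument, in the normalization of \<open>normalized_op\<close>: the
  derivatives that fell on the second argument are distributed over all three by the Leibniz rule.
\<close>

definition dual2 :: "(nat \<Rightarrow> nat \<Rightarrow> nat \<Rightarrow> real) \<Rightarrow> nat \<Rightarrow> nat \<Rightarrow> nat \<Rightarrow> real" where
  "dual2 X i j l = (\<Sum>p\<le>i. \<Sum>q\<le>l. real (i choose p) * real (l choose q) * (- 1) ^ (6 - p - q) * X p (6 - p - q) q)"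

lemma higher_pderiv_mult3:
  fixes u v w :: "real poly"
  shows "(pderiv ^^ n) (u * w * v) = (\<Sum>r\<le>n. \<Sum>s\<le>n - r. smult (fact n / (fact r * fact s * fact (n - r - s)))
      ((pderiv ^^ r) u * (pderiv ^^ (n - r - s)) w * (pderiv ^^ s) v))"
proof -
  have "(pderiv ^^ n) (u * w * v) = (pderiv ^^ n) (u * (v * w))"
    by (simp add: ac_simps)
  also have "\<dots> = (\<Sum>r\<le>n. \<Sum>s\<le>n - r. smult ((n choose r) * (n - r choose s))
      ((pderiv ^^ r) u * ((pderiv ^^ s) v * (pderiv ^^ (n - r - s)) w)))"
    unfolding higher_pderiv_mult sum_distrib_left smult_sum_right by simp
  also have "\<dots> = (\<Sum>r\<le>n. \<Sum>s\<le>n - r. smult (fact n / (fact r * fact s * fact (n - r - s)))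
      ((pderiv ^^ r) u * (pderiv ^^ (n - r - s)) w * (pderiv ^^ s) v))"
    by (intro sum.cong refl) (simp add: binomial_fact ac_simps)
  finally show ?thesis .
qed

lemma adjoint_const_diff_op:
  "(\<Sum>(p, j, q)\<in>{(p, j, q). p + j + q = 6}.
      smult (X p j q / (fact p * fact j * fact q) * (- 1) ^ j)
        (nth_pderiv j (nth_pderiv p \<phi> * \<omega> * nth_pderiv q \<theta>))) =
    const_diff_op 6 (\<lambda>i j l. dual2 X i j l / (fact i * fact j * fact l)) \<phi> \<omega> \<theta>"
proof -
  let ?S = "{(p, j, q). p + j + q = (6::nat)}"
  define c where "c p q = X p (6 - p - q) q * (- 1) ^ (6 - p - q)" for p q
  define T where "T i j l p q = smult (c p q / (fact p * fact q * fact (i - p) * fact (l - q) * fact j))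
     (nth_pderiv i \<phi> * nth_pderiv j \<omega> * nth_pderiv l \<theta>)" for i j l p q
  have fin: "finite ?S" by (rule finite_triples)
  have "(\<Sum>(p, j, q)\<in>?S. smult (X p j q / (fact p * fact j * fact q) * (- 1) ^ j)
        (nth_pderiv j (nth_pderiv p \<phi> * \<omega> * nth_pderiv q \<theta>))) =
      (\<Sum>x\<in>?S. \<Sum>y\<in>(case x of (p, j, q) \<Rightarrow> SIGMA r : {..j}. {..j - r}).
        case (x, y) of ((p, j, q), (r, s)) \<Rightarrow> T (p + r) (j - r - s) (q + s) p q)"
  proof (rule sum.cong[OF refl])
    fix x assume "x \<in> ?S"
    then obtain p j q where x: "x = (p, j, q)" and s: "p + j + q = 6" by auto
    have "6 - p - q = j" using s by simp
    then have c: "c p q = X p j q * (- 1) ^ j" by (simp only: c_def)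
    have "smult (X p j q / (fact p * fact j * fact q) * (- 1) ^ j)
        (nth_pderiv j (nth_pderiv p \<phi> * \<omega> * nth_pderiv q \<theta>)) =
      (\<Sum>r\<le>j. \<Sum>s\<le>j - r. T (p + r) (j - r - s) (q + s) p q)"
      unfolding higher_pderiv_mult3 smult_sum_right
      by (intro sum.cong refl) (simp add: T_def c higher_pderiv_comp ac_simps)
    also have "\<dots> = (\<Sum>(r, s)\<in>(SIGMA r : {..j}. {..j - r}). T (p + r) (j - r - s) (q + s) p q)"
      by (rule sum.Sigma) auto
    finally show "(case x of (p, j, q) \<Rightarrow> smult (X p j q / (fact p * fact j * fact q) * (- 1) ^ j)
        (nth_pderiv j (nth_pderiv p \<phi> * \<omega> * nth_pderiv q \<theta>))) =
      (\<Sum>y\<in>(case x of (p, j, q) \<Rightarrow> SIGMA r : {..j}. {..j - r}).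
        case (x, y) of ((p, j, q), (r, s)) \<Rightarrow> T (p + r) (j - r - s) (q + s) p q)"
      unfolding x by simp
  qed
  also have "\<dots> = (\<Sum>(x, y)\<in>(SIGMA x : ?S. case x of (p, j, q) \<Rightarrow> SIGMA r : {..j}. {..j - r}).
        case (x, y) of ((p, j, q), (r, s)) \<Rightarrow> T (p + r) (j - r - s) (q + s) p q)"
    by (rule sum.Sigma[OF fin]) auto
  also have "\<dots> = (\<Sum>(x, y)\<in>(SIGMA x : ?S. case x of (i, j, l) \<Rightarrow> {..i} \<times> {..l}).
        case (x, y) of ((i, j, l), (p, q)) \<Rightarrow> T i j l p q)"
    by (rule sum.reindex_bij_witness[of _ "\<lambda>((i, j, l), (p, q)). ((p, 6 - p - q, q), (i - p, l - q))"
          "\<lambda>((p, j, q), (r, s)). ((p + r, j - r - s, q + s), (p, q))"]) auto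
  also have "\<dots> = (\<Sum>x\<in>?S. \<Sum>y\<in>(case x of (i, j, l) \<Rightarrow> {..i} \<times> {..l}).
        case (x, y) of ((i, j, l), (p, q)) \<Rightarrow> T i j l p q)"
    by (rule sum.Sigma[OF fin, symmetric]) auto
  also have "\<dots> = const_diff_op 6 (\<lambda>i j l. dual2 X i j l / (fact i * fact j * fact l)) \<phi> \<omega> \<theta>"
    unfolding const_diff_op_def
  proof (rule sum.cong[OF refl])
    fix x assume "x \<in> ?S"
    obtain i j l where x: "x = (i, j, l)" by (cases x)
    have "dual2 X i j l / (fact i * fact j * fact l) =
      (\<Sum>(p, q)\<in>{..i} \<times> {..l}. c p q / (fact p * fact q * fact (i - p) * fact (l - q) * fact j))"
      unfolding dual2_def sum_divide_distrib sum.cartesian_product c_def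
      by (intro sum.cong refl) (auto simp: binomial_fact field_simps)
    then show "(\<Sum>y\<in>(case x of (i, j, l) \<Rightarrow> {..i} \<times> {..l}).
        case (x, y) of ((i, j, l), (p, q)) \<Rightarrow> T i j l p q) =
      (case x of (i, j, l) \<Rightarrow> smult (dual2 X i j l / (fact i * fact j * fact l))
         (nth_pderiv i \<phi> * nth_pderiv j \<omega> * nth_pderiv l \<theta>))"
      by (simp add: x smult_sum split_def T_def)
  qed
  finally show ?thesis .
qed

lemma perm_or_dual_dual2:
  "perm_or_dual (normalized_op a g t X) (normalized_op a (- 5 - a - g - t) t (dual2 X))"
proof -
  have "dualization2 (normalized_op a g t X) (normalized_op a (- 5 - a - g - t) t (dual2 X))"
    unfolding dualization2_def
  proof (intro exI conjI)
    show "op_map (normalized_op a g t X) = const_diff_op 6 (\<lambda>i j l. X i j l / (fact i * fact j * fact l))"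
      by (simp add: normalized_op_def)
    show "normalized_op a (- 5 - a - g - t) t (dual2 X) =
      Ternary (wt1 (normalized_op a g t X)) (1 - wt_target (normalized_op a g t X))
       (wt3 (normalized_op a g t X)) (1 - wt2 (normalized_op a g t X))
       (\<lambda>\<phi> \<omega> \<theta>. \<Sum>(i, j, l)\<in>{(i, j, l). i + j + l = 6}.
           smult (X i j l / (fact i * fact j * fact l) * (- 1) ^ j)
            (nth_pderiv j (nth_pderiv i \<phi> * \<omega> * nth_pderiv l \<theta>)))"
      unfolding adjoint_const_diff_op by (simp add: normalized_op_def)
  qed
  then show ?thesis by (simp add: perm_or_dual_def)
qed

lemma dual2_fact:
  "dual2 X i j l = (\<Sum>p\<le>i. \<Sum>q\<le>l. fact i / (fact p * fact (i - p)) * (fact l / (fact q * fact (l - q)))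
     * (- 1) ^ (6 - p - q) * X p (6 - p - q) q)"
  unfolding dual2_def by (intro sum.cong refl) (simp add: binomial_fact)

section \<open>Coefficients of the listed operators\<close>

lemma sum_triples:
  "(\<Sum>(i, j, l)\<in>{(i, j, l). i + j + l = (k::nat)}. F i j l) = (\<Sum>i\<le>k. \<Sum>j\<le>k - i. F i j (k - i - j))"
  unfolding sum.Sigma[OF finite_atMost ballI[OF finite_atMost]]
  by (rule sum.reindex_bij_witness[of _ "\<lambda>(i, j). (i, j, k - i - j)" "\<lambda>(i, j, l). (i, j)"]) auto

lemma higher_pderiv_pderiv: "(pderiv ^^ n) (pderiv p) = (pderiv ^^ Suc n) p"
  by (simp add: funpow_swap1)

definition upsilon_coeff :: "nat \<Rightarrow> nat \<Rightarrow> nat \<Rightarrow> real" where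
  "upsilon_coeff i j l =
    (if (i, j, l) \<in> {(0, 1, 5), (1, 5, 0), (5, 0, 1)} then 1
     else if (i, j, l) \<in> {(0, 5, 1), (5, 1, 0), (1, 0, 5)} then - 1
     else if (i, j, l) \<in> {(0, 2, 4), (2, 4, 0), (4, 0, 2)} then 5 / 2
     else if (i, j, l) \<in> {(0, 4, 2), (4, 2, 0), (2, 0, 4)} then - 5 / 2
     else if (i, j, l) \<in> {(1, 2, 3), (2, 3, 1), (3, 1, 2)} then 2
     else if (i, j, l) \<in> {(1, 3, 2), (3, 2, 1), (2, 1, 3)} then - 2 else 0)"

text \<open>
  In \<open>Xi_d_d\<close> the third argument takes the first place of \<open>Xi 1\<close> and the other two enter through their
  derivatives, hence the permutation of the indices and the shifts.
\<close>

definition xi_d_d_coeff :: "nat \<Rightarrow> nat \<Rightarrow> nat \<Rightarrow> real" where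
  "xi_d_d_coeff i j l = (if i = 0 \<or> j = 0 then 0 else xi_coeff 1 l (i - 1) (j - 1))"

lemma Delta_d_d_d_eq: "Delta_d_d_d = Ternary 0 0 0 6 (const_diff_op 6 delta_coeff)"
proof -
  have "det_deriv 0 1 2 (de_rham \<phi>) (de_rham \<psi>) (de_rham \<theta>) = const_diff_op 6 delta_coeff \<phi> \<psi> \<theta>" for \<phi> \<psi> \<theta>
    unfolding det_deriv_def det_3 const_diff_op_def sum_triples delta_coeff_def de_rham_def higher_pderiv_pderiv
    by (simp add: atMost_nat_numeral vector_3 numeral_2_eq_2[symmetric] algebra_simps del: funpow.simps)
  then show ?thesis by (simp add: Delta_d_d_d_def Delta3_def fun_eq_iff)
qed

lemma Upsilon_eq: "Upsilon = Ternary (- 5 / 4) (- 5 / 4) (- 5 / 4) (9 / 4) (const_diff_op 6 upsilon_coeff)"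
proof -
  have "det_deriv 0 1 5 \<phi> \<psi> \<theta> + smult (5 / 2) (det_deriv 0 2 4 \<phi> \<psi> \<theta>) + smult 2 (det_deriv 1 2 3 \<phi> \<psi> \<theta>) =
     const_diff_op 6 upsilon_coeff \<phi> \<psi> \<theta>" for \<phi> \<psi> \<theta>
    unfolding det_deriv_def det_3 const_diff_op_def sum_triples upsilon_coeff_def
    by (simp add: atMost_nat_numeral vector_3 numeral_2_eq_2[symmetric] smult_add_right smult_diff_right algebra_simps del: funpow.simps)
  then show ?thesis by (simp add: Upsilon_def fun_eq_iff)
qed

lemma Xi_d_d_eq: "Xi_d_d = Ternary 0 0 (- 5 / 2) (7 / 2) (const_diff_op 6 xi_d_d_coeff)"
proof -
  have "const_diff_op 4 (xi_coeff 1) \<theta> (de_rham \<phi>) (de_rham \<psi>) = const_diff_op 6 xi_d_d_coeff \<phi> \<psi> \<theta>" for \<phi> \<psi> \<theta>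
    unfolding const_diff_op_def sum_triples xi_d_d_coeff_def xi_coeff_def de_rham_def higher_pderiv_pderiv
    by (simp add: atMost_nat_numeral numeral_2_eq_2[symmetric] algebra_simps del: funpow.simps)
  then show ?thesis by (simp add: Xi_d_d_def Xi_def fun_eq_iff)
qed

lemma normalized_op_eq_scale_op:
  assumes "\<forall>i j l. i + j + l = 6 \<longrightarrow> X i j l = c * \<beta> i j l * (fact i * fact j * fact l)"
    and "B = Ternary a g t m (const_diff_op 6 \<beta>)" "m = a + g + t + 6"
  shows "normalized_op a g t X = scale_op c B"
proof -
  have "const_diff_op 6 (\<lambda>i j l. X i j l / (fact i * fact j * fact l)) = const_diff_op 6 (\<lambda>i j l. c * \<beta> i j l)"
    by (rule const_diff_op_cong) (simp add: assms(1))
  then show ?thesis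
    by (simp add: normalized_op_def scale_op_def assms(2,3) const_diff_op_scale)
qed

section \<open>Classification\<close>

definition equivalent_to_listed :: "ternary_op \<Rightarrow> bool" where
  "equivalent_to_listed A \<longleftrightarrow> (\<exists>B c. perm_dual_related A B \<and>
    (B = scale_op c Delta_d_d_d \<or> B = scale_op c Xi_d_d \<or> B = scale_op c Upsilon))"

lemma equivalent_to_listedI:
  "A = scale_op c Delta_d_d_d \<Longrightarrow> equivalent_to_listed A"
  "A = scale_op c Xi_d_d \<Longrightarrow> equivalent_to_listed A"
  "A = scale_op c Upsilon \<Longrightarrow> equivalent_to_listed A"
  unfolding equivalent_to_listed_def perm_dual_related_def by blast+

lemma equivalent_to_listed_step:
  assumes "perm_or_dual A A'" "equivalent_to_listed A'"
  shows "equivalent_to_listed A"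
  using assms unfolding equivalent_to_listed_def perm_dual_related_def
  by (blast intro: converse_rtranclp_into_rtranclp)

text \<open>
  The formula of \<open>off_edge\<close> solved for \<open>X i k l\<close>, for \<open>g \<noteq> 0\<close>.
\<close>

definition from_edge :: "real \<Rightarrow> real \<Rightarrow> real \<Rightarrow> (nat \<Rightarrow> real) \<Rightarrow> nat \<Rightarrow> nat \<Rightarrow> nat \<Rightarrow> real" where
  "from_edge a g t f i k l = (if k = 0 then f i
     else - ((i + (k + 1) * a) * f (i + k) + (l + (k + 1) * t) * f i) / ((k + 1) * g))"

lemma eq_from_edge:
  assumes X: "vect_relations a g t X" and g: "g \<noteq> 0" and s: "i + k + l = 6"
  shows "X i k l = from_edge a g t (\<lambda>i. X i 0 (6 - i)) i k l"
proof (cases "k = 0")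
  case True
  then have "l = 6 - i" using s by simp
  with True show ?thesis by (simp add: from_edge_def)
next
  case False
  have u: "6 - (i + k) = l" "6 - i = l + k" using s by auto
  have "(k + 1) * g \<noteq> 0" using g by simp
  with False off_edge[OF X, of k i l] s show ?thesis
    by (simp add: from_edge_def u nonzero_eq_divide_eq ac_simps)
qed

lemma normalized_op_cong:
  assumes "\<And>i j l. i + j + l = 6 \<Longrightarrow> X i j l = Y i j l"
  shows "normalized_op a g t X = normalized_op a g t Y"
  unfolding normalized_op_def using assms by (auto intro!: const_diff_op_cong)

lemma edge_nonzero:
  assumes X: "vect_relations a g t X" and g: "g \<noteq> 0" and s: "i + j + l = 6" "X i j l \<noteq> 0"
  obtains m where "X m 0 (6 - m) \<noteq> 0" "m \<le> 6"
proof -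
  have "\<not> (\<forall>m\<le>6. X m 0 (6 - m) = 0)"
  proof
    assume "\<forall>m\<le>6. X m 0 (6 - m) = 0"
    then have "from_edge a g t (\<lambda>i. X i 0 (6 - i)) i j l = 0" using s by (simp add: from_edge_def)
    then show False using eq_from_edge[OF X g s(1)] s(2) by simp
  qed
  then show ?thesis using that by blast
qed

text \<open>
  In each case the edge values are known up to a factor \<open>u\<close>, hence so are all coefficients, and the
  operator is compared with the listed one entry by entry.  The multiples of the listed operators
  are read off from the entry \<open>(5, 0, 1)\<close> for \<open>Upsilon\<close>, \<open>(5, 1, 0)\<close> for \<open>Xi_d_d\<close> and \<open>(1, 2, 3)\<close> for
  \<open>Delta_d_d_d\<close>.
\<close>

lemma classification_nonzero_middle:
  assumes X: "vect_relations a g t X" and g: "g \<noteq> 0" and nz: "i + j + l = 6" "X i j l \<noteq> 0"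
    and at: "a = 0 \<or> t \<noteq> 0"
  shows "equivalent_to_listed (normalized_op a g t X)"
proof -
  define f where "f i = X i 0 (6 - i)" for i
  have op: "normalized_op a g t X = normalized_op a g t (from_edge a g t f)"
    unfolding f_def[abs_def] by (rule normalized_op_cong) (rule eq_from_edge[OF X g])
  have f: "edge_relations a g t f"
    using edge_relations_of_vect_relations[OF X] by (simp add: f_def[abs_def])
  obtain m where m: "f m \<noteq> 0" "m \<le> 6"
    using edge_nonzero[OF X g nz] by (auto simp: f_def)
  consider "a \<noteq> 0" "t \<noteq> 0" | "a = 0" "t \<noteq> 0" | "a = 0" "t = 0" using at by auto
  then show ?thesis
  proof cases
    case 1
    define u where "u = f 1"
    have w: "a = - 5 / 4" "g = - 5 / 4" "t = - 5 / 4" and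
      v: "f 0 = 0" "f (Suc 0) = u" "f 2 = u" "f 3 = 0" "f 4 = - u" "f 5 = - u" "f 6 = 0"
      using edge_nonzero_weights[OF f 1 m] by (auto simp: u_def)
    have "normalized_op a g t X = scale_op (- u / 120) Upsilon"
      unfolding op
    proof (rule normalized_op_eq_scale_op[where \<beta> = upsilon_coeff and m = "9 / 4"])
      show "\<forall>i j l. i + j + l = 6 \<longrightarrow>
          from_edge a g t f i j l = - u / 120 * upsilon_coeff i j l * (fact i * fact j * fact l)"
        unfolding all_triples_iff
        by (simp add: triple_simps from_edge_def w v upsilon_coeff_def)
    qed (simp_all add: Upsilon_eq w)
    then show ?thesis by (rule equivalent_to_listedI)
  next
    case 2
    \<comment> \<open>The divisors of the edge values here and below make the other values integral multiples.\<close>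
    define u where "u = f 5 / 22"
    have w: "a = 0" "g = - 5 / 2" "t = - 5 / 2" and
      v: "f 0 = 0" "f (Suc 0) = 3 * u" "f 2 = 8 * u" "f 3 = 15 * u" "f 4 = 22 * u" "f 5 = 22 * u" "f 6 = 0"
      using edge_one_zero_weight[OF f[unfolded 2] 2(2) m] 2 by (auto simp: u_def)
    have "normalized_op a (- 5 - a - g - t) t (dual2 (from_edge a g t f)) = scale_op (u / 200) Xi_d_d"
    proof (rule normalized_op_eq_scale_op[where \<beta> = xi_d_d_coeff and m = "7 / 2"])
      show "\<forall>i j l. i + j + l = 6 \<longrightarrow>
          dual2 (from_edge a g t f) i j l = u / 200 * xi_d_d_coeff i j l * (fact i * fact j * fact l)"
        unfolding all_triples_iff
        by (simp add: triple_simps from_edge_def w v xi_d_d_coeff_def xi_coeff_def dual2_fact)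
    qed (simp_all add: Xi_d_d_eq w)
    then show ?thesis unfolding op
      by (rule equivalent_to_listed_step[OF perm_or_dual_dual2 equivalent_to_listedI(2)])
  next
    case 3
    define u where "u = f 1 / 3"
    have v: "f 0 = 0" "f (Suc 0) = 3 * u" "f 3 = 0" "f 4 = - f 2" "f 5 = - 3 * u" "f 6 = 0" and
      c: "g = - 5 \<and> f 2 = 3 * u \<or> g = - 5 / 2 \<and> f 2 = - 2 * u"
      using edge_two_zero_weights[OF f[unfolded 3] m] 3 by (auto simp: u_def)
    from c show ?thesis
    proof (elim disjE conjE)
      assume w: "g = - 5" "f 2 = 3 * u"
      have "normalized_op a (- 5 - a - g - t) t (dual2 (from_edge a g t f)) = scale_op (u / 80) Delta_d_d_d"
      proof (rule normalized_op_eq_scale_op[where \<beta> = delta_coeff and m = 6])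
        show "\<forall>i j l. i + j + l = 6 \<longrightarrow>
            dual2 (from_edge a g t f) i j l = u / 80 * delta_coeff i j l * (fact i * fact j * fact l)"
          unfolding all_triples_iff
          by (simp add: triple_simps from_edge_def w 3 v delta_coeff_def dual2_fact)
      qed (simp_all add: Delta_d_d_d_eq w 3)
      then show ?thesis unfolding op
        by (rule equivalent_to_listed_step[OF perm_or_dual_dual2 equivalent_to_listedI(1)])
    next
      assume w: "g = - 5 / 2" "f 2 = - 2 * u"
      have "normalized_op a t g (\<lambda>i j l. from_edge a g t f i l j) = scale_op (u / 200) Xi_d_d"
      proof (rule normalized_op_eq_scale_op[where \<beta> = xi_d_d_coeff and m = "7 / 2"])
        show "\<forall>i j l. i + j + l = 6 \<longrightarrow>
            from_edge a g t f i l j = u / 200 * xi_d_d_coeff i j l * (fact i * fact j * fact l)"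
          unfolding all_triples_iff
          by (simp add: triple_simps from_edge_def w 3 v xi_d_d_coeff_def xi_coeff_def)
      qed (simp_all add: Xi_d_d_eq w 3)
      then show ?thesis unfolding op
        by (rule equivalent_to_listed_step[OF perm_or_dual_swap23 equivalent_to_listedI(2)])
    qed
  qed
qed

text \<open>
  The transpositions bring the weights into one of the shapes treated above: a nonzero middle weight,
  with a last weight that vanishes only if the first one does, or all weights zero.
\<close>

lemma classification:
  assumes X: "vect_relations a g t X" and nz: "i + j + l = 6" "X i j l \<noteq> 0"
  shows "equivalent_to_listed (normalized_op a g t X)"
proof -
  have s12: "equivalent_to_listed (normalized_op g a t (\<lambda>i j l. X j i l)) \<Longrightarrow> ?thesis"
    by (rule equivalent_to_listed_step[OF perm_or_dual_swap12])
  have s23: "equivalent_to_listed (normalized_op a t g (\<lambda>i j l. X i l j)) \<Longrightarrow> ?thesis"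
    by (rule equivalent_to_listed_step[OF perm_or_dual_swap23])
  consider "a = 0" "g = 0" "t = 0" | "g \<noteq> 0" "a = 0 \<or> t \<noteq> 0" | "g = 0" "a \<noteq> 0"
    | "g = 0" "a = 0" "t \<noteq> 0" | "g \<noteq> 0" "a \<noteq> 0" "t = 0" by blast
  then show ?thesis
  proof cases
    case 1
    have "normalized_op a g t X = scale_op (X 1 2 3 / 12) Delta_d_d_d"
      using zero_weights[OF X[unfolded 1]]
      by (rule normalized_op_eq_scale_op) (simp_all add: 1 Delta_d_d_d_eq)
    then show ?thesis by (rule equivalent_to_listedI)
  next
    case 2
    show ?thesis by (rule classification_nonzero_middle[OF X 2(1) nz 2(2)])
  next
    case 3
    show ?thesis
      by (rule s12, rule classification_nonzero_middle[OF vect_relations_swap12[OF X] 3(2), of j i l])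
        (use nz 3 in auto)
  next
    case 4
    show ?thesis
      by (rule s23, rule classification_nonzero_middle[OF vect_relations_swap23[OF X] 4(3), of i l j])
        (use nz 4 in auto)
  next
    case 5
    have "equivalent_to_listed (normalized_op t a g (\<lambda>i j l. X j l i))"
      by (rule classification_nonzero_middle[OF vect_relations_swap12[OF vect_relations_swap23[OF X]] 5(2), of l i j])
        (use nz 5 in auto)
    then show ?thesis
      by (rule s23[OF equivalent_to_listed_step[OF perm_or_dual_swap12]])
  qed
qed

theorem theorem2p7:
  fixes lam gam tau :: real and A :: poly_map3
  assumes "diff_op_of_order 6 A"
    and "vect1_invariant (Ternary lam gam tau (lam + gam + tau + 6) A)"
  shows "\<exists>B c. perm_dual_related (Ternary lam gam tau (lam + gam + tau + 6) A) B \<and>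
    (B = scale_op c Delta_d_d_d \<or> B = scale_op c Xi_d_d \<or> B = scale_op c Upsilon)"
proof -
  from assms(1) obtain p i j l where A: "A = poly_diff_op 6 p"
    and nz: "i + j + l = 6" "p i j l \<noteq> 0"
    unfolding diff_op_of_order_def poly_diff_op_def by blast
  have inv: "vect1_invariant (Ternary lam gam tau (lam + gam + tau + (6::nat)) (poly_diff_op 6 p))"
    using assms(2) A by simp
  obtain X where X: "poly_diff_op 6 p = const_diff_op 6 (\<lambda>i j l. X i j l / (fact i * fact j * fact l))"
    and rel: "\<And>n i j l. 1 \<le> n \<Longrightarrow> i + j + l + n = 6 \<Longrightarrow>
       (i + (n + 1) * lam) * X (i + n) j l + (j + (n + 1) * gam) * X i (j + n) l
       + (l + (n + 1) * tau) * X i j (l + n) = 0"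
    and p: "\<And>i j l. i + j + l = 6 \<Longrightarrow> p i j l = [:X i j l / (fact i * fact j * fact l):]"
    using invariant_poly_diff_op[OF inv] by blast
  have "vect_relations lam gam tau X"
    unfolding vect_relations_def
  proof (intro allI impI)
    fix n i j l :: nat
    assume "1 \<le> n" "i + j + l + n = 6"
    from rel[OF this] show "(i + (n + 1) * lam) * X (i + n) j l + (j + (n + 1) * gam) * X i (j + n) l
       + (l + (n + 1) * tau) * X i j (l + n) = 0"
      by (simp add: add.commute)
  qed
  moreover have "X i j l \<noteq> 0"
    using p[OF nz(1)] nz(2) by auto
  ultimately have "equivalent_to_listed (normalized_op lam gam tau X)"
    by (intro classification[OF _ nz(1)])
  then show ?thesis
    unfolding equivalent_to_listed_def normalized_op_def A X .
qed

end
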